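(* Let $V(t)$, $t\in\mathbb R$, be a centered stationary ergodic Gaussian process with continuous sample paths and $\operatorname{Var}(V(t))=\sigma^2\in(0,\infty)$, and let $R_V(t)=\operatorname{Cov}(V(0),V(t))$. Then $$\lim_{T\to\infty}\mathcal G_V(T)=0.$$ Additionally, if the Pickands condition $$R_V(0)-R_V(t)=A|t|^\alpha+o(|t|^\alpha),\qquad t\to0,$$ is valid with some $\alpha\in(0,2]$ and $A>0$, and the Berman condition $$\lim_{T\to\infty}\ln(T)\,R_V(T)=0$$ holds, then, as $T\to\infty$, $$\mathcal G_V(T)\sim \exp\Big(\mathbb E\Big\{\inf_{t\in[0,T]}\sqrt2V(t)-\sigma^2\Big\}\Big)\sim e^{-2\sigma\sqrt{\ln T}-\sigma^2}.$$ Under the Berman condition $\lim_{T\to\infty}\ln(T)R_V(T)=0$, for every $C\in\mathbb R$ and every $m>0$, $$p_V(T,C)=o(T^{-m}),\qquad T\to\infty.$$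
   Context: For a centered Gaussian process $V$ with variance function $\sigma_V^2(t)=\operatorname{Var}(V(t))$ (here constant, equal to $\sigma^2$, with $\sigma>0$), $$\mathcal G_V(T)=\mathbb E\Big\{\inf_{t\in[0,T]}e^{\sqrt2V(t)-\sigma_V^2(t)}\Big\},\qquad p_V(T,C)=\mathbb P\Big\{\inf_{t\in[0,T]}(\sqrt2V(t)-\sigma_V^2(t))>C\Big\}.$$ $f(T)\sim g(T)$ means $f(T)/g(T)\to1$. *)

theory Defs
  imports "HOL-Probability.Probability" "HOL-Library.Landau_Symbols"
begin

definition gaussian_rv :: "'a measure \<Rightarrow> ('a \<Rightarrow> real) \<Rightarrow> bool" where
  "gaussian_rv M Y \<longleftrightarrow> Y \<in> borel_measurable M \<and>
     (\<exists>\<mu> \<tau>. (\<tau> > 0 \<and> distributed M lborel Y (normal_density \<mu> \<tau>)) \<or> (AE \<omega> in M. Y \<omega> = \<mu>))"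
  \<comment> \<open>Point masses count as Gaussian laws with zero variance.\<close>

definition gaussian_process :: "'a measure \<Rightarrow> (real \<Rightarrow> 'a \<Rightarrow> real) \<Rightarrow> bool" where
  "gaussian_process M V \<longleftrightarrow> (\<forall>t. V t \<in> borel_measurable M) \<and>
     (\<forall>(J :: real set) (a :: real \<Rightarrow> real). finite J \<longrightarrow> gaussian_rv M (\<lambda>\<omega>. \<Sum>t\<in>J. a t * V t \<omega>))"

definition centered_process :: "'a measure \<Rightarrow> (real \<Rightarrow> 'a \<Rightarrow> real) \<Rightarrow> bool" where
  "centered_process M V \<longleftrightarrow> (\<forall>t. prob_space.expectation M (V t) = 0)"

definition continuous_sample_paths :: "'a measure \<Rightarrow> (real \<Rightarrow> 'a \<Rightarrow> real) \<Rightarrow> bool" where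
  "continuous_sample_paths M V \<longleftrightarrow> (\<forall>\<omega>\<in>space M. continuous_on UNIV (\<lambda>t. V t \<omega>))"

definition path_shift :: "(real \<Rightarrow> 'a \<Rightarrow> real) \<Rightarrow> real \<Rightarrow> 'a \<Rightarrow> (real \<Rightarrow> real)" where
  "path_shift V s \<omega> = (\<lambda>t. V (t + s) \<omega>)"

abbreviation path_space :: "(real \<Rightarrow> real) measure" where
  "path_space \<equiv> (\<Pi>\<^sub>M t\<in>(UNIV :: real set). (borel :: real measure))"

definition stationary_process :: "'a measure \<Rightarrow> (real \<Rightarrow> 'a \<Rightarrow> real) \<Rightarrow> bool" where
  "stationary_process M V \<longleftrightarrow>
     (\<forall>s. distr M path_space (path_shift V s) = distr M path_space (path_shift V 0))"

text \<open>
  Ergodicity of the shift flow under the law of the process. Invariance of an event has to be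
  read modulo null sets: an event of the product sigma-algebra on all functions depends on
  countably many coordinates only, so the only events invariant on the nose under every real
  shift are the empty set and the whole space, and the condition would be void.
\<close>

definition ergodic_process :: "'a measure \<Rightarrow> (real \<Rightarrow> 'a \<Rightarrow> real) \<Rightarrow> bool" where
  "ergodic_process M V \<longleftrightarrow>
     (\<forall>A\<in>sets path_space.
        (\<forall>s. AE \<omega> in M. path_shift V s \<omega> \<in> A \<longleftrightarrow> path_shift V 0 \<omega> \<in> A) \<longrightarrow>
        measure (distr M path_space (path_shift V 0)) A \<in> {0, 1})"

definition covariance :: "'a measure \<Rightarrow> ('a \<Rightarrow> real) \<Rightarrow> ('a \<Rightarrow> real) \<Rightarrow> real" where
  "covariance M X Y = prob_space.expectation M
     (\<lambda>\<omega>. (X \<omega> - prob_space.expectation M X) * (Y \<omega> - prob_space.expectation M Y))"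

definition R_cov :: "'a measure \<Rightarrow> (real \<Rightarrow> 'a \<Rightarrow> real) \<Rightarrow> real \<Rightarrow> real" where
  "R_cov M V t = covariance M (V 0) (V t)"

definition G_inf :: "'a measure \<Rightarrow> (real \<Rightarrow> 'a \<Rightarrow> real) \<Rightarrow> real \<Rightarrow> real" where
  "G_inf M V T = prob_space.expectation M
     (\<lambda>\<omega>. INF t\<in>{0..T}. exp (sqrt 2 * V t \<omega> - prob_space.variance M (V t)))"

definition p_inf :: "'a measure \<Rightarrow> (real \<Rightarrow> 'a \<Rightarrow> real) \<Rightarrow> real \<Rightarrow> real \<Rightarrow> real" where
  "p_inf M V T C = prob_space.prob M
     {\<omega> \<in> space M. (INF t\<in>{0..T}. sqrt 2 * V t \<omega> - prob_space.variance M (V t)) > C}"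

definition pickands_condition :: "(real \<Rightarrow> real) \<Rightarrow> real \<Rightarrow> real \<Rightarrow> bool" where
  "pickands_condition R A \<alpha> \<longleftrightarrow>
     (\<lambda>t. R 0 - R t - A * \<bar>t\<bar> powr \<alpha>) \<in> o[at 0](\<lambda>t. \<bar>t\<bar> powr \<alpha>)"

definition berman_condition :: "(real \<Rightarrow> real) \<Rightarrow> bool" where
  "berman_condition R \<longleftrightarrow> ((\<lambda>T. ln T * R T) \<longlongrightarrow> 0) at_top"

end

theory Submission
  imports Defs "HOL-Real_Asymp.Real_Asymp"
begin

text \<open>
  Write \<open>S T\<close> for the supremum of \<open>- V\<close> over \<open>[0, T]\<close>, so that the infimum in \<open>G_inf\<close> is
  \<open>exp (- sqrt 2 S T - \<sigma>\<^sup>2)\<close>.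

  By ergodicity the event that \<open>- V\<close> stays below a level on a half-line has probability 0 or 1, and
  1 is impossible for a nondegenerate Gaussian law; hence \<open>S T\<close> tends to infinity almost surely and
  dominated convergence gives the first claim.

  For the quantitative claims, on a grid of spacing \<open>\<Delta>\<close> the covariances are at most
  \<open>\<kappa> = \<eta> / ln \<Delta>\<close> by the Berman condition, and Slepian's inequality compares the grid with the
  equicorrelated vector \<open>sqrt \<kappa> Z + sqrt (\<sigma>\<^sup>2 - \<kappa>) Z_j\<close>. Spacing \<open>sqrt T\<close> yields the decay of
  \<open>p_inf\<close>. Spacing \<open>exp (c sqrt (ln T))\<close> shows that \<open>S T \<le> sqrt 2 \<sigma> sqrt (ln T) - \<epsilon>\<close> is so
  unlikely that \<open>E exp (sqrt 2 (sqrt 2 \<sigma> sqrt (ln T) - S T))\<close> has upper limit at most 1. Chaining with the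
  Pickands condition gives \<open>E (S T) \<le> sqrt 2 \<sigma> sqrt (ln T) + o(1)\<close>, and Jensen's inequality closes the loop
  between the two bounds.
\<close>

section \<open>Gaussian vectors and Slepian's inequality\<close>

text \<open>The equivalences require the supremum up to o(1), not only its leading term, and this
  fixes the scales. With \<open>L = sqrt (ln T)\<close>, thinning to spacing
  \<open>exp (c * L)\<close> lowers the level \<open>sqrt 2 * \<sigma> * L\<close> by a constant
  proportional to \<open>c\<close> only, since sqrt (L^2 - c L) = L - c/2 + o(1). The covariance
  bound is then of order \<open>1 / L\<close>, so a cut of the common part at order
  \<open>sqrt L\<close> again moves the level by a constant. The exceptional probability
  \<open>exp (- K * L / 2)\<close> has to beat the factor \<open>exp (2 * \<sigma> * L)\<close> by
  which G is renormalised; \<open>K\<close> may be as large as desired because Berman's condition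
  makes \<open>\<eta>\<close> as small as desired. A power of T as spacing would lose a fixed
  fraction of the level and suits only the fixed level \<open>C\<close>. Gaussian vectors are
  described by characteristic functions, which admits singular covariances. Uniqueness of their laws
  is reduced, one coordinate at a time, to the one-dimensional Levy theorem, and Slepian's
  inequality is proved by couplings instead of differentiating Gaussian densities.\<close>

text \<open>Normalising the weights to densities turns the hypothesis into equality of two
  characteristic functions, so Levy uniqueness applies. The case \<open>t = 0\<close> shows that
  both weights have the same mass \<open>m\<close>; if \<open>m = 0\<close> the densities do not
  exist, but then both weights vanish almost everywhere.\<close>

lemma weighted_char_unique:
  fixes X w :: "'a \<Rightarrow> real" and X' w' :: "'b \<Rightarrow> real" and g :: "real \<Rightarrow> real"
  assumes "prob_space M" "prob_space M'"
    and [measurable]: "X \<in> borel_measurable M" "w \<in> borel_measurable M"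
      "X' \<in> borel_measurable M'" "w' \<in> borel_measurable M'" "g \<in> borel_measurable borel"
    and w: "\<And>x. 0 \<le> w x" "\<And>x. w x \<le> B" and w': "\<And>x. 0 \<le> w' x" "\<And>x. w' x \<le> B"
    and eq: "\<And>t. (CLINT x|M. complex_of_real (w x) * iexp (t * X x)) =
      (CLINT x|M'. complex_of_real (w' x) * iexp (t * X' x))"
  shows "(\<integral>x. w x * g (X x) \<partial>M) = (\<integral>x. w' x * g (X' x) \<partial>M')"
proof -
  interpret M: prob_space M by fact
  interpret M': prob_space M' by fact
  define m where "m = (\<integral>x. w x \<partial>M)"
  have int: "integrable M w" "integrable M' w'"
    using w w' by (auto intro!: M.integrable_const_bound[where B = B] M'.integrable_const_bound[where B = B])
  have m': "m = (\<integral>x. w' x \<partial>M')"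
  proof -
    have "(CLINT x|M. complex_of_real (w x)) = (CLINT x|M'. complex_of_real (w' x))"
      using eq[of 0] by simp
    then show ?thesis unfolding m_def integral_complex_of_real by (simp only: of_real_eq_iff)
  qed
  show ?thesis
  proof (cases "m = 0")
    case True
    have "AE x in M. w x = 0"
      using True int w unfolding m_def by (subst (asm) integral_nonneg_eq_0_iff_AE) auto
    moreover have "AE x in M'. w' x = 0"
      using True int w' unfolding m' by (subst (asm) integral_nonneg_eq_0_iff_AE) auto
    ultimately have "(\<integral>x. w x * g (X x) \<partial>M) = 0" "(\<integral>x. w' x * g (X' x) \<partial>M') = 0"
      by (auto intro!: integral_eq_zero_AE elim!: AE_mp)
    then show ?thesis by simp
  next
    case False
    then have m: "m > 0"
      using w unfolding m_def by (simp add: order.not_eq_order_implies_strict integral_nonneg_AE)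
    define D where "D = density M (\<lambda>x. ennreal (w x / m))"
    define D' where "D' = density M' (\<lambda>x. ennreal (w' x / m))"
    have PD: "prob_space D"
    proof
      have "emeasure D (space D) = (\<integral>\<^sup>+x. ennreal (w x / m) \<partial>M)"
        unfolding D_def by (simp add: emeasure_density cong: nn_integral_cong)
      also have "\<dots> = ennreal (\<integral>x. w x / m \<partial>M)"
        using int w m by (intro nn_integral_eq_integral) auto
      finally show "emeasure D (space D) = 1" using m by (simp add: m_def)
    qed
    have PD': "prob_space D'"
    proof
      have "emeasure D' (space D') = (\<integral>\<^sup>+x. ennreal (w' x / m) \<partial>M')"
        unfolding D'_def by (simp add: emeasure_density cong: nn_integral_cong)
      also have "\<dots> = ennreal (\<integral>x. w' x / m \<partial>M')"
        using int w' m by (intro nn_integral_eq_integral) auto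
      finally show "emeasure D' (space D') = 1" using m by (simp add: m')
    qed
    have [measurable]: "X \<in> borel_measurable D" "X' \<in> borel_measurable D'"
      by (auto simp: D_def D'_def)
    have "distr D borel X = distr D' borel X'"
    proof (rule Levy_uniqueness)
      show "real_distribution (distr D borel X)" "real_distribution (distr D' borel X')"
        using prob_space.real_distribution_distr[OF PD] prob_space.real_distribution_distr[OF PD'] by auto
      show "char (distr D borel X) = char (distr D' borel X')"
      proof
        fix t
        have "char (distr D borel X) t = (CLINT x|M. (w x / m) *\<^sub>R iexp (t * X x))"
          unfolding char_def using w m
          by (subst integral_distr) (auto simp: D_def integral_density)
        also have "\<dots> = (CLINT x|M. complex_of_real (1 / m) * (complex_of_real (w x) * iexp (t * X x)))"
          by (simp add: scaleR_conv_of_real)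
        also have "\<dots> = complex_of_real (1 / m) * (CLINT x|M. complex_of_real (w x) * iexp (t * X x))"
          by (rule integral_mult_right_zero)
        also have "\<dots> = complex_of_real (1 / m) * (CLINT x|M'. complex_of_real (w' x) * iexp (t * X' x))"
          by (simp only: eq)
        also have "\<dots> = (CLINT x|M'. complex_of_real (1 / m) * (complex_of_real (w' x) * iexp (t * X' x)))"
          by (rule integral_mult_right_zero[symmetric])
        also have "\<dots> = (CLINT x|M'. (w' x / m) *\<^sub>R iexp (t * X' x))"
          by (simp add: scaleR_conv_of_real)
        also have "\<dots> = char (distr D' borel X') t"
          unfolding char_def using w' m
          by (subst integral_distr) (auto simp: D'_def integral_density)
        finally show "char (distr D borel X) t = char (distr D' borel X') t" .
      qed
    qed
    then have "(\<integral>x. g x \<partial>distr D borel X) = (\<integral>x. g x \<partial>distr D' borel X')" by simp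
    then have "(\<integral>x. w x / m * g (X x) \<partial>M) = (\<integral>x. w' x / m * g (X' x) \<partial>M')"
      using w w' m by (simp add: integral_distr D_def D'_def integral_density)
    then show ?thesis using m by simp
  qed
qed

text \<open>Exchanges one exponential factor for \<open>g\<close> while the factor
  \<open>iexp (S x)\<close> survives. That factor is complex and cannot enter a weight directly, but
  \<open>1 + cos S\<close> and \<open>1 + sin S\<close> lie between 0 and 2; applying the
  real-weight result to them and subtracting the case of the plain weight recovers the real and
  imaginary parts.\<close>

lemma weighted_joint_char_unique:
  fixes X w S :: "'a \<Rightarrow> real" and X' w' S' :: "'b \<Rightarrow> real" and g :: "real \<Rightarrow> real"
  assumes M: "prob_space M" and M': "prob_space M'"
    and [measurable]: "X \<in> borel_measurable M" "w \<in> borel_measurable M" "S \<in> borel_measurable M"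
      "X' \<in> borel_measurable M'" "w' \<in> borel_measurable M'" "S' \<in> borel_measurable M'"
      "g \<in> borel_measurable borel"
    and w: "\<And>x. 0 \<le> w x" "\<And>x. w x \<le> 1" and w': "\<And>x. 0 \<le> w' x" "\<And>x. w' x \<le> 1"
    and g: "\<And>x. 0 \<le> g x" "\<And>x. g x \<le> 1"
    and eq: "\<And>t e. (CLINT x|M. complex_of_real (w x) * iexp (t * X x + e * S x)) =
      (CLINT x|M'. complex_of_real (w' x) * iexp (t * X' x + e * S' x))"
  shows "(CLINT x|M. complex_of_real (w x * g (X x)) * iexp (S x)) =
      (CLINT x|M'. complex_of_real (w' x * g (X' x)) * iexp (S' x))"
proof -
  interpret M: prob_space M by fact
  interpret M': prob_space M' by fact
  have ib: "integrable M f" if "f \<in> borel_measurable M" "\<And>x. norm (f x) \<le> 2" for f :: "'a \<Rightarrow> complex"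
    using that by (auto intro!: M.integrable_const_bound[where B = 2])
  have ib': "integrable M' f" if "f \<in> borel_measurable M'" "\<And>x. norm (f x) \<le> 2" for f :: "'b \<Rightarrow> complex"
    using that by (auto intro!: M'.integrable_const_bound[where B = 2])
  have ir: "integrable M f" if "f \<in> borel_measurable M" "\<And>x. norm (f x) \<le> 2" for f :: "'a \<Rightarrow> real"
    using that by (auto intro!: M.integrable_const_bound[where B = 2])
  have ir': "integrable M' f" if "f \<in> borel_measurable M'" "\<And>x. norm (f x) \<le> 2" for f :: "'b \<Rightarrow> real"
    using that by (auto intro!: M'.integrable_const_bound[where B = 2])
  have cosE: "complex_of_real (cos s) = (iexp s + iexp (- s)) / 2" for s
    by (simp add: complex_eq_iff Re_exp Im_exp)
  have sinE: "complex_of_real (sin s) = (iexp s - iexp (- s)) / (2 * \<i>)" for s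
    by (simp add: complex_eq_iff Re_exp Im_exp Re_divide Im_divide)
  have wle: "\<bar>w x\<bar> \<le> 1" "\<bar>w' y\<bar> \<le> 1" "\<bar>w x\<bar> \<le> 2" "\<bar>w' y\<bar> \<le> 2" for x y
    using w[of x] w'[of y] by auto
  have iexp_add: "iexp (p + e * q) = iexp p * iexp (e * q)" for p q e :: real
    by (simp only: of_real_add distrib_left exp_add)
  have ring_cos: "W * (1 + (p + q) / 2) * u = W * (u * 1) + (W * (u * p) + W * (u * q)) / 2"
    and ring_sin: "W * (1 + (p - q) / (2 * \<i>)) * u = W * (u * 1) + (W * (u * p) - W * (u * q)) / (2 * \<i>)"
    for W p q u :: complex
    by (simp_all add: field_simps)
  \<comment> \<open>Writing cosine and sine through \<open>iexp s\<close> and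
    \<open>iexp (- s)\<close> splits the new weight into instances of \<open>eq\<close> with
    \<open>e = 0\<close>, \<open>1\<close> and \<open>-1\<close>.\<close>
  have cpt: "complex_of_real (v * (1 + cos s)) * iexp p =
      complex_of_real v * iexp (p + 0 * s) + (complex_of_real v * iexp (p + 1 * s)
       + complex_of_real v * iexp (p + (-1) * s)) / 2" for v s p :: real
    unfolding iexp_add of_real_mult[of v] of_real_add[of 1] cosE of_real_1 ring_cos
    by (simp only: mult_zero_left of_real_0 mult_zero_right exp_zero mult_1_left mult_minus1)
  have spt: "complex_of_real (v * (1 + sin s)) * iexp p =
      complex_of_real v * iexp (p + 0 * s) + (complex_of_real v * iexp (p + 1 * s)
       - complex_of_real v * iexp (p + (-1) * s)) / (2 * \<i>)" for v s p :: real
    unfolding iexp_add of_real_mult[of v] of_real_add[of 1] sinE of_real_1 ring_sin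
    by (simp only: mult_zero_left of_real_0 mult_zero_right exp_zero mult_1_left mult_minus1)
  have I: "integrable M (\<lambda>x. complex_of_real (w x) * iexp (t * X x + e * S x))" for t e
    by (rule ib) (auto simp: norm_mult wle)
  have I': "integrable M' (\<lambda>x. complex_of_real (w' x) * iexp (t * X' x + e * S' x))" for t e
    by (rule ib') (auto simp: norm_mult wle)
  have b2: "0 \<le> v * (1 + z)" "v * (1 + z) \<le> 2" if "0 \<le> v" "v \<le> 1" "-1 \<le> z" "z \<le> 1" for v z :: real
    using that mult_mono[of v 1 "1 + z" 2] by auto
  have 1: "(\<integral>x. w x * g (X x) \<partial>M) = (\<integral>x. w' x * g (X' x) \<partial>M')"
    by (rule weighted_char_unique[OF M M', where B = 1 and w = w and w' = w' and X = X and X' = X' and g = g]) (use eq[where e = 0] w w' in auto)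
  have 2: "(\<integral>x. w x * (1 + cos (S x)) * g (X x) \<partial>M) = (\<integral>x. w' x * (1 + cos (S' x)) * g (X' x) \<partial>M')"
  proof (rule weighted_char_unique[OF M M', where B = 2 and X = X and X' = X' and g = g and w = "\<lambda>x. w x * (1 + cos (S x))" and w' = "\<lambda>x. w' x * (1 + cos (S' x))"])
    show "(CLINT x|M. complex_of_real (w x * (1 + cos (S x))) * iexp (t * X x)) =
        (CLINT x|M'. complex_of_real (w' x * (1 + cos (S' x))) * iexp (t * X' x))" for t
      unfolding cpt using I[of t] I'[of t] by (simp only: Bochner_Integration.integral_add
        integral_divide_zero Bochner_Integration.integrable_add integrable_divide_zero eq)
  qed (use w w' in \<open>auto intro!: b2\<close>)
  have 3: "(\<integral>x. w x * (1 + sin (S x)) * g (X x) \<partial>M) = (\<integral>x. w' x * (1 + sin (S' x)) * g (X' x) \<partial>M')"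
  proof (rule weighted_char_unique[OF M M', where B = 2 and X = X and X' = X' and g = g and w = "\<lambda>x. w x * (1 + sin (S x))" and w' = "\<lambda>x. w' x * (1 + sin (S' x))"])
    show "(CLINT x|M. complex_of_real (w x * (1 + sin (S x))) * iexp (t * X x)) =
        (CLINT x|M'. complex_of_real (w' x * (1 + sin (S' x))) * iexp (t * X' x))" for t
      unfolding spt using I[of t] I'[of t] by (simp only: Bochner_Integration.integral_add
        Bochner_Integration.integral_diff Bochner_Integration.integrable_diff
        integral_divide_zero Bochner_Integration.integrable_add integrable_divide_zero eq)
  qed (use w w' in \<open>auto intro!: b2\<close>)
  have wg: "\<bar>w x * g y\<bar> \<le> 1" "\<bar>w' x' * g y\<bar> \<le> 1" for x x' y
    using w[of x] w'[of x'] g[of y] by (auto simp: abs_mult mult_le_one)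
  have wgt: "\<bar>w x * g y * z\<bar> \<le> 2" "\<bar>w' x' * g y * z\<bar> \<le> 2" if "\<bar>z\<bar> \<le> 1" for x x' y z
    using mult_le_one[OF wg(1)[of x y] _ that] mult_le_one[OF wg(2)[of x' y] _ that] by (auto simp: abs_mult)
  have le2: "\<bar>z\<bar> \<le> 2" if "\<bar>z\<bar> \<le> 1" for z :: real using that by simp
  have Ig: "integrable M (\<lambda>x. w x * g (X x))" "integrable M (\<lambda>x. w x * g (X x) * cos (S x))"
    "integrable M (\<lambda>x. w x * g (X x) * sin (S x))" "integrable M' (\<lambda>x. w' x * g (X' x))"
    "integrable M' (\<lambda>x. w' x * g (X' x) * cos (S' x))" "integrable M' (\<lambda>x. w' x * g (X' x) * sin (S' x))"
    by (auto intro!: ir ir' simp del: abs_mult simp: wgt[simplified] le2[OF wg(1)] le2[OF wg(2)])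
  have C: "(\<integral>x. w x * g (X x) * cos (S x) \<partial>M) = (\<integral>x. w' x * g (X' x) * cos (S' x) \<partial>M')"
    using 2 1 Ig by (simp add: algebra_simps)
  have Sn: "(\<integral>x. w x * g (X x) * sin (S x) \<partial>M) = (\<integral>x. w' x * g (X' x) * sin (S' x) \<partial>M')"
    using 3 1 Ig by (simp add: algebra_simps)
  have "(CLINT x|M. complex_of_real (w x * g (X x)) * iexp (S x)) =
     (CLINT x|M. complex_of_real (w x * g (X x) * cos (S x)) + \<i> * complex_of_real (w x * g (X x) * sin (S x)))"
    by (intro Bochner_Integration.integral_cong) (auto simp: complex_eq_iff Re_exp Im_exp)
  also have "\<dots> = complex_of_real (\<integral>x. w x * g (X x) * cos (S x) \<partial>M) + \<i> * complex_of_real (\<integral>x. w x * g (X x) * sin (S x) \<partial>M)"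
    using Ig by (subst Bochner_Integration.integral_add)
      (auto simp only: integrable_of_real integrable_mult_right integral_mult_right_zero integral_complex_of_real)
  also have "\<dots> = complex_of_real (\<integral>x. w' x * g (X' x) * cos (S' x) \<partial>M') + \<i> * complex_of_real (\<integral>x. w' x * g (X' x) * sin (S' x) \<partial>M')"
    by (simp only: C Sn)
  also have "\<dots> = (CLINT x|M'. complex_of_real (w' x * g (X' x) * cos (S' x)) + \<i> * complex_of_real (w' x * g (X' x) * sin (S' x)))"
    using Ig by (subst Bochner_Integration.integral_add)
      (auto simp only: integrable_of_real integrable_mult_right integral_mult_right_zero integral_complex_of_real)
  also have "\<dots> = (CLINT x|M'. complex_of_real (w' x * g (X' x)) * iexp (S' x))"
    by (intro Bochner_Integration.integral_cong) (auto simp: complex_eq_iff Re_exp Im_exp)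
  finally show ?thesis .
qed

section \<open>Centered Gaussian vectors\<close>

text \<open>Characteristic functions instead of densities: singular covariances are included, and
  sums of independent vectors simply add their matrices. Only the entries of \<open>K\<close> below
  \<open>n\<close> matter.\<close>

definition gauss_vec :: "'a measure \<Rightarrow> nat \<Rightarrow> (nat \<Rightarrow> nat \<Rightarrow> real) \<Rightarrow> (nat \<Rightarrow> 'a \<Rightarrow> real) \<Rightarrow> bool" where
  "gauss_vec M n K X \<longleftrightarrow> prob_space M \<and> (\<forall>j<n. X j \<in> borel_measurable M) \<and>
     (\<forall>a. (CLINT x|M. iexp (\<Sum>j<n. a j * X j x)) =
        complex_of_real (exp (- (\<Sum>i<n. \<Sum>j<n. a i * a j * K i j) / 2)))"

lemma gauss_vecD:
  assumes "gauss_vec M n K X"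
  shows "prob_space M" "\<And>j. j < n \<Longrightarrow> X j \<in> borel_measurable M"
    "\<And>a. (CLINT x|M. iexp (\<Sum>j<n. a j * X j x)) =
        complex_of_real (exp (- (\<Sum>i<n. \<Sum>j<n. a i * a j * K i j) / 2))"
  using assms by (auto simp: gauss_vec_def)

lemma gauss_vec_cong:
  assumes "gauss_vec M n K X" "\<And>i j. i < n \<Longrightarrow> j < n \<Longrightarrow> K i j = L i j"
  shows "gauss_vec M n L X"
proof -
  have "(\<Sum>i<n. \<Sum>j<n. a i * a j * K i j) = (\<Sum>i<n. \<Sum>j<n. a i * a j * L i j)" for a
    using assms(2) by (intro sum.cong) auto
  then show ?thesis using assms(1) unfolding gauss_vec_def by simp
qed

text \<open>The first \<open>k\<close> coordinates already carry \<open>g\<close> while the others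
  still sit in the exponent. Hence \<open>k = 0\<close> is equality of characteristic functions,
  \<open>k = n\<close> is the product formula, and each step converts one coordinate.\<close>

lemma gauss_vec_prod_unique_aux:
  fixes g :: "real \<Rightarrow> real"
  assumes G: "gauss_vec M n K X" and G': "gauss_vec M' n K X'"
    and g[measurable]: "g \<in> borel_measurable borel" and g01: "\<And>x. 0 \<le> g x" "\<And>x. g x \<le> 1"
    and "k \<le> n"
  shows "(CLINT x|M. complex_of_real (\<Prod>j<k. g (X j x)) * iexp (\<Sum>j\<in>{k..<n}. a j * X j x)) =
    (CLINT x|M'. complex_of_real (\<Prod>j<k. g (X' j x)) * iexp (\<Sum>j\<in>{k..<n}. a j * X' j x))"
  using \<open>k \<le> n\<close>
proof (induction k arbitrary: a)
  case 0
  then show ?case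
    using gauss_vecD(3)[OF G, of a] gauss_vecD(3)[OF G', of a] by (simp add: atLeast0LessThan)
next
  case (Suc k)
  note [measurable] = gauss_vecD(2)[OF G] gauss_vecD(2)[OF G']
  have k: "k < n" using Suc.prems by simp
  \<comment> \<open>The induction hypothesis holds for all coefficients, so it can be used with a
    free frequency \<open>t\<close> at coordinate \<open>k\<close> and a common factor
    \<open>e\<close> on the later ones.\<close>
  have split: "(\<Sum>j\<in>{k..<n}. (\<lambda>j. if j = k then t else e * a j) j * Y j) =
      t * Y k + e * (\<Sum>j\<in>{Suc k..<n}. a j * Y j)" for t e and Y :: "nat \<Rightarrow> real"
  proof -
    have "{k..<n} = insert k {Suc k..<n}" using k by auto
    then show ?thesis by (auto simp: sum_distrib_left mult.assoc intro!: sum.cong)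
  qed
  have "(CLINT x|M. complex_of_real ((\<Prod>j<k. g (X j x)) * g (X k x)) * iexp (\<Sum>j\<in>{Suc k..<n}. a j * X j x)) =
    (CLINT x|M'. complex_of_real ((\<Prod>j<k. g (X' j x)) * g (X' k x)) * iexp (\<Sum>j\<in>{Suc k..<n}. a j * X' j x))"
  proof (rule weighted_joint_char_unique[OF gauss_vecD(1)[OF G] gauss_vecD(1)[OF G'],
        where w = "\<lambda>x. \<Prod>j<k. g (X j x)" and w' = "\<lambda>x. \<Prod>j<k. g (X' j x)" and X = "X k" and X' = "X' k" and g = g
          and S = "\<lambda>x. \<Sum>j\<in>{Suc k..<n}. a j * X j x" and S' = "\<lambda>x. \<Sum>j\<in>{Suc k..<n}. a j * X' j x"])
    show "(CLINT x|M. complex_of_real (\<Prod>j<k. g (X j x)) * iexp (t * X k x + e * (\<Sum>j\<in>{Suc k..<n}. a j * X j x))) =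
      (CLINT x|M'. complex_of_real (\<Prod>j<k. g (X' j x)) * iexp (t * X' k x + e * (\<Sum>j\<in>{Suc k..<n}. a j * X' j x)))"
      for t e
      using Suc.IH[of "\<lambda>j. if j = k then t else e * a j"] k unfolding split by simp
  qed (use k g01 in \<open>auto intro!: prod_nonneg prod_le_1\<close>)
  then show ?case by simp
qed

lemma gauss_vec_prod_unique:
  fixes g :: "real \<Rightarrow> real"
  assumes G: "gauss_vec M n K X" and G': "gauss_vec M' n K X'"
    and "g \<in> borel_measurable borel" "\<And>x. 0 \<le> g x" "\<And>x. g x \<le> 1"
  shows "(\<integral>x. (\<Prod>j<n. g (X j x)) \<partial>M) = (\<integral>x. (\<Prod>j<n. g (X' j x)) \<partial>M')"
proof -
  have "(CLINT x|M. complex_of_real (\<Prod>j<n. g (X j x))) = (CLINT x|M'. complex_of_real (\<Prod>j<n. g (X' j x)))"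
    using gauss_vec_prod_unique_aux[OF assms order_refl] by simp
  then show ?thesis unfolding integral_complex_of_real by (simp only: of_real_eq_iff)
qed

lemma gauss_vec_coord_scale:
  assumes "gauss_vec M n K X"
  shows "gauss_vec M n (\<lambda>i j. c i * c j * K i j) (\<lambda>j x. c j * X j x)"
  unfolding gauss_vec_def
proof (intro conjI allI impI)
  show "(CLINT x|M. iexp (\<Sum>j<n. a j * (c j * X j x))) =
     complex_of_real (exp (- (\<Sum>i<n. \<Sum>j<n. a i * a j * (c i * c j * K i j)) / 2))" for a
    using gauss_vecD(3)[OF assms, of "\<lambda>j. a j * c j"] by (simp add: mult_ac)
qed (use gauss_vecD[OF assms] in auto)

lemma gauss_vec_sum:
  assumes G: "gauss_vec M n K X" and H: "gauss_vec N n L Y"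
  shows "gauss_vec (M \<Otimes>\<^sub>M N) n (\<lambda>i j. K i j + L i j) (\<lambda>j z. X j (fst z) + Y j (snd z))"
  unfolding gauss_vec_def
proof (intro conjI allI impI)
  interpret M: prob_space M by (rule gauss_vecD[OF G])
  interpret N: prob_space N by (rule gauss_vecD[OF H])
  interpret P: pair_prob_space M N ..
  note [measurable] = gauss_vecD(2)[OF G] gauss_vecD(2)[OF H]
  show "prob_space (M \<Otimes>\<^sub>M N)" by (rule P.prob_space_axioms)
  show "(\<lambda>z. X j (fst z) + Y j (snd z)) \<in> borel_measurable (M \<Otimes>\<^sub>M N)" if "j < n" for j
    using that by measurable
  fix a
  let ?S = "\<lambda>x. \<Sum>j<n. a j * X j x" and ?R = "\<lambda>y. \<Sum>j<n. a j * Y j y"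
  have [measurable]: "?S \<in> borel_measurable M" "?R \<in> borel_measurable N" by (auto intro!: borel_measurable_sum)
  have "(CLINT z|M \<Otimes>\<^sub>M N. iexp (\<Sum>j<n. a j * (X j (fst z) + Y j (snd z)))) =
     (CLINT z|M \<Otimes>\<^sub>M N. iexp (?S (fst z)) * iexp (?R (snd z)))"
    by (simp add: sum.distrib distrib_left exp_add)
  also have "\<dots> = (CLINT x|M. CLINT y|N. iexp (?S x) * iexp (?R y))"
    by (subst P.integral_fst'[symmetric]) (auto intro!: P.integrable_const_bound[where B = 1] simp: norm_mult)
  also have "\<dots> = (CLINT x|M. iexp (?S x)) * (CLINT y|N. iexp (?R y))"
    by simp
  also have "\<dots> = complex_of_real (exp (- (\<Sum>i<n. \<Sum>j<n. a i * a j * (K i j + L i j)) / 2))"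
    unfolding gauss_vecD(3)[OF G] gauss_vecD(3)[OF H]
    by (simp only: sum.distrib distrib_left minus_add_distrib add_divide_distrib exp_add of_real_mult)
  finally show "(CLINT z|M \<Otimes>\<^sub>M N. iexp (\<Sum>j<n. a j * (X j (fst z) + Y j (snd z)))) =
     complex_of_real (exp (- (\<Sum>i<n. \<Sum>j<n. a i * a j * (K i j + L i j)) / 2))" .
qed

lemma gauss_vec_rank1:
  "gauss_vec std_normal_distribution n (\<lambda>i j. v i * v j) (\<lambda>j z. v j * z)"
  unfolding gauss_vec_def
proof (intro conjI allI impI)
  show "prob_space std_normal_distribution"
    using real_dist_normal_dist by (simp add: real_distribution_def)
  fix a
  have "(CLINT x|std_normal_distribution. iexp (\<Sum>j<n. a j * (v j * x))) =
     char std_normal_distribution (\<Sum>j<n. a j * v j)"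
    unfolding char_def by (simp add: sum_distrib_right mult.assoc)
  also have "\<dots> = complex_of_real (exp (- (\<Sum>i<n. \<Sum>j<n. a i * a j * (v i * v j)) / 2))"
    by (simp add: char_std_normal_distribution power2_eq_square sum_product mult_ac)
  finally show "(CLINT x|std_normal_distribution. iexp (\<Sum>j<n. a j * (v j * x))) =
     complex_of_real (exp (- (\<Sum>i<n. \<Sum>j<n. a i * a j * (v i * v j)) / 2))" .
qed auto

lemma gauss_vec_iid:
  "gauss_vec (\<Pi>\<^sub>M j\<in>{..<n}. std_normal_distribution) n (\<lambda>i j. if i = j then 1 else 0) (\<lambda>j y. y j)"
  unfolding gauss_vec_def
proof (intro conjI allI impI)
  interpret S: prob_space std_normal_distribution
    using real_dist_normal_dist by (simp add: real_distribution_def)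
  interpret P: product_prob_space "\<lambda>j. std_normal_distribution" "{..<n}" ..
  show "prob_space (\<Pi>\<^sub>M j\<in>{..<n}. std_normal_distribution)" by (rule P.prob_space_axioms)
  show "(\<lambda>y. y j) \<in> borel_measurable (\<Pi>\<^sub>M j\<in>{..<n}. std_normal_distribution)" if "j < n" for j
    using measurable_component_singleton[of j "{..<n}" "\<lambda>_. std_normal_distribution"] that by simp
  fix a :: "nat \<Rightarrow> real"
  have "(CLINT y|(\<Pi>\<^sub>M j\<in>{..<n}. std_normal_distribution). iexp (\<Sum>j<n. a j * y j)) =
     (CLINT y|(\<Pi>\<^sub>M j\<in>{..<n}. std_normal_distribution). \<Prod>j<n. iexp (a j * y j))"
    by (simp add: sum_distrib_left exp_sum)
  also have "\<dots> = (\<Prod>j<n. CLINT x|std_normal_distribution. iexp (a j * x))"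
    by (rule P.product_integral_prod) (auto intro!: S.integrable_const_bound[where B = 1])
  also have "\<dots> = (\<Prod>j<n. complex_of_real (exp (- (a j)\<^sup>2 / 2)))"
    using char_std_normal_distribution by (simp add: char_def fun_eq_iff)
  also have "\<dots> = complex_of_real (exp (- (\<Sum>i<n. \<Sum>j<n. a i * a j * (if i = j then 1 else 0)) / 2))"
    by (simp add: exp_sum[symmetric] sum_negf sum_divide_distrib power2_eq_square
        if_distrib[of "\<lambda>x. _ * x"] sum.delta flip: of_real_prod cong: if_cong)
  finally show "(CLINT y|(\<Pi>\<^sub>M j\<in>{..<n}. std_normal_distribution). iexp (\<Sum>j<n. a j * y j)) =
     complex_of_real (exp (- (\<Sum>i<n. \<Sum>j<n. a i * a j * (if i = j then 1 else 0)) / 2))" .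
qed

lemma gauss_vec_distr:
  assumes G: "gauss_vec M n K X"
  shows "gauss_vec (distr M (\<Pi>\<^sub>M j\<in>{..<n}. (borel :: real measure)) (\<lambda>x. \<lambda>j\<in>{..<n}. X j x)) n K (\<lambda>j y. y j)"
  unfolding gauss_vec_def
proof (intro conjI allI impI)
  note [measurable] = gauss_vecD(2)[OF G]
  have m[measurable]: "(\<lambda>x. \<lambda>j\<in>{..<n}. X j x) \<in> measurable M (\<Pi>\<^sub>M j\<in>{..<n}. borel)"
    by (rule measurable_restrict) auto
  show "prob_space (distr M (\<Pi>\<^sub>M j\<in>{..<n}. borel) (\<lambda>x. \<lambda>j\<in>{..<n}. X j x))"
    by (rule prob_space.prob_space_distr[OF gauss_vecD(1)[OF G] m])
  have c: "(\<lambda>y. y j) \<in> borel_measurable (\<Pi>\<^sub>M j\<in>{..<n}. (borel :: real measure))" if "j < n" for j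
    using measurable_component_singleton[of j "{..<n}" "\<lambda>_. borel"] that by simp
  then show "(\<lambda>y. y j) \<in> borel_measurable (distr M (\<Pi>\<^sub>M j\<in>{..<n}. borel) (\<lambda>x. \<lambda>j\<in>{..<n}. X j x))"
    if "j < n" for j
    using that by simp
  note [measurable] = c
  show "(CLINT x|distr M (\<Pi>\<^sub>M j\<in>{..<n}. borel) (\<lambda>x. \<lambda>j\<in>{..<n}. X j x). iexp (\<Sum>j<n. a j * x j)) =
     complex_of_real (exp (- (\<Sum>i<n. \<Sum>j<n. a i * a j * K i j) / 2))" for a
    using gauss_vecD(3)[OF G, of a] by (subst integral_distr) auto
qed

text \<open>The choice of the type of the sample space is immaterial by \<open>gauss_vec_distr\<close>.\<close>

definition gauss_cov :: "nat \<Rightarrow> (nat \<Rightarrow> nat \<Rightarrow> real) \<Rightarrow> bool" where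
  "gauss_cov n K \<longleftrightarrow> (\<exists>(P :: (nat \<Rightarrow> real) measure) X. gauss_vec P n K X)"

lemma gauss_covI: "gauss_vec M n K X \<Longrightarrow> gauss_cov n K"
  unfolding gauss_cov_def using gauss_vec_distr by blast

lemma gauss_cov_cong:
  "gauss_cov n K \<Longrightarrow> (\<And>i j. i < n \<Longrightarrow> j < n \<Longrightarrow> K i j = L i j) \<Longrightarrow> gauss_cov n L"
  unfolding gauss_cov_def using gauss_vec_cong by blast

lemma gauss_cov_add: "gauss_cov n K \<Longrightarrow> gauss_cov n L \<Longrightarrow> gauss_cov n (\<lambda>i j. K i j + L i j)"
  unfolding gauss_cov_def[of n K] gauss_cov_def[of n L] using gauss_vec_sum gauss_covI by blast

lemma gauss_cov_scale: "gauss_cov n K \<Longrightarrow> c \<ge> 0 \<Longrightarrow> gauss_cov n (\<lambda>i j. c * K i j)"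
  unfolding gauss_cov_def[of n K] using gauss_covI[OF gauss_vec_coord_scale[where c = "\<lambda>_. sqrt c"]] by auto

lemma gauss_cov_rank1: "gauss_cov n (\<lambda>i j. v i * v j)"
  using gauss_covI[OF gauss_vec_rank1] .

lemma gauss_cov_diag:
  assumes "\<And>i. i < n \<Longrightarrow> d i \<ge> 0"
  shows "gauss_cov n (\<lambda>i j. if i = j then d i else 0)"
  by (rule gauss_cov_cong[OF gauss_covI[OF gauss_vec_coord_scale[OF gauss_vec_iid, of n "\<lambda>i. sqrt (d i)"]]])
    (use assms in auto)

text \<open>A functional of the covariance alone, so that comparison can move through matrices
  without fixing a probability space. The choice of vector is immaterial by
  \<open>gauss_prod_unique\<close>-type uniqueness as soon as \<open>K\<close> is a Gaussian
  covariance.\<close>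

definition gauss_prod :: "nat \<Rightarrow> (real \<Rightarrow> real) \<Rightarrow> (nat \<Rightarrow> nat \<Rightarrow> real) \<Rightarrow> real" where
  "gauss_prod n g K = (let (P :: (nat \<Rightarrow> real) measure, X) = (SOME (P, X). gauss_vec P n K X)
     in \<integral>x. (\<Prod>j<n. g (X j x)) \<partial>P)"

lemma gauss_prod_eq:
  assumes G: "gauss_vec M n K X"
    and g: "g \<in> borel_measurable borel" "\<And>x. 0 \<le> g x" "\<And>x. g x \<le> 1"
  shows "(\<integral>x. (\<Prod>j<n. g (X j x)) \<partial>M) = gauss_prod n g K"
proof -
  obtain P :: "(nat \<Rightarrow> real) measure" and Y where PY: "(P, Y) = (SOME (P, X). gauss_vec P n K X)"
    by (metis surj_pair)
  have "\<exists>Q. case Q of (P :: (nat \<Rightarrow> real) measure, X) \<Rightarrow> gauss_vec P n K X"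
    using gauss_covI[OF G] unfolding gauss_cov_def by auto
  then have "gauss_vec P n K Y" using someI_ex[of "\<lambda>Q. case Q of (P, X) \<Rightarrow> gauss_vec P n K X"] PY
    by (metis (mono_tags, lifting) case_prod_conv)
  from gauss_vec_prod_unique[OF G this g] show ?thesis
    unfolding gauss_prod_def PY[symmetric] by simp
qed

section \<open>Slepian's inequality by elementary swaps\<close>

text \<open>A vector and its negative have the same outer product, so each side may be averaged over
  the sign of the independent normal. After averaging, the integrands differ by a product of two
  increments of \<open>g\<close> over symmetric arguments, times the remaining factors; both
  increments have the same sign because \<open>g\<close> is antitone.\<close>

lemma gauss_prod_swap:
  fixes g :: "real \<Rightarrow> real" and r :: real
  assumes B: "gauss_cov n B" and ij: "i < n" "j < n" "i \<noteq> j"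
    and g[measurable]: "g \<in> borel_measurable borel" and g01: "\<And>x. 0 \<le> g x" "\<And>x. g x \<le> 1" and anti: "antimono g"
  defines "u \<equiv> \<lambda>k. if k = i then r else if k = j then - r else 0"
    and "w \<equiv> \<lambda>k. if k = i then r else if k = j then r else 0"
  shows "gauss_prod n g (\<lambda>k l. B k l + u k * u l) \<le> gauss_prod n g (\<lambda>k l. B k l + w k * w l)"
proof -
  obtain P :: "(nat \<Rightarrow> real) measure" and X where P: "gauss_vec P n B X"
    using B unfolding gauss_cov_def by blast
  let ?M = "P \<Otimes>\<^sub>M std_normal_distribution"
  let ?F = "\<lambda>v z. \<Prod>k<n. g (X k (fst z) + v k * snd z)"
  have v: "gauss_vec ?M n (\<lambda>k l. B k l + v k * v l) (\<lambda>k z. X k (fst z) + v k * snd z)" for v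
    by (rule gauss_vec_sum[OF P gauss_vec_rank1])
  have eq: "gauss_prod n g (\<lambda>k l. B k l + v k * v l) = (\<integral>z. ?F v z \<partial>?M)" for v
    by (rule gauss_prod_eq[OF v g g01, symmetric])
  interpret M: prob_space ?M using v gauss_vecD(1) by blast
  note [measurable] = gauss_vecD(2)[OF P]
  have F01: "0 \<le> ?F v z" "?F v z \<le> 1" for v z
    using g01 by (auto intro!: prod_nonneg prod_le_1)
  have int: "integrable ?M (?F v)" for v
    by (rule M.integrable_const_bound[where B = 1]) (use F01 in \<open>auto simp: abs_of_nonneg\<close>)
  have "?F u z + ?F (\<lambda>k. - u k) z \<le> ?F w z + ?F (\<lambda>k. - w k) z" for z
  proof -
    define Q where "Q = (\<Prod>k\<in>{..<n} - {i, j}. g (X k (fst z)))"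
    have F: "?F v z = g (X i (fst z) + v i * snd z) * (g (X j (fst z) + v j * snd z) * Q)"
      if "\<And>k. k \<noteq> i \<Longrightarrow> k \<noteq> j \<Longrightarrow> v k = 0" for v
    proof -
      have s: "{..<n} = insert i (insert j ({..<n} - {i, j}))" using ij by auto
      show ?thesis unfolding Q_def using ij that by (subst s) (auto intro!: arg_cong2[where f = "(*)"] prod.cong)
    qed
    let ?a = "\<lambda>e. g (X i (fst z) + e * snd z)" and ?b = "\<lambda>e. g (X j (fst z) + e * snd z)"
    have "0 \<le> (?a r - ?a (- r)) * (?b r - ?b (- r))"
    proof (cases "r * snd z \<ge> 0")
      case True
      then show ?thesis by (intro mult_nonpos_nonpos) (auto intro!: antimonoD[OF anti])
    next
      case False
      then show ?thesis by (intro mult_nonneg_nonneg) (auto intro!: antimonoD[OF anti])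
    qed
    then have "0 \<le> (?a r - ?a (- r)) * (?b r - ?b (- r)) * Q"
      by (rule mult_nonneg_nonneg) (auto simp: Q_def g01 intro!: prod_nonneg)
    moreover have "?F u z = ?a r * (?b (- r) * Q)" "?F (\<lambda>k. - u k) z = ?a (- r) * (?b r * Q)"
      "?F w z = ?a r * (?b r * Q)" "?F (\<lambda>k. - w k) z = ?a (- r) * (?b (- r) * Q)"
      using ij by (subst F; simp add: u_def w_def)+
    ultimately show ?thesis by (simp add: algebra_simps)
  qed
  then have "(\<integral>z. ?F u z + ?F (\<lambda>k. - u k) z \<partial>?M) \<le> (\<integral>z. ?F w z + ?F (\<lambda>k. - w k) z \<partial>?M)"
    by (intro integral_mono Bochner_Integration.integrable_add int) auto
  then have "(\<integral>z. ?F u z \<partial>?M) + (\<integral>z. ?F (\<lambda>k. - u k) z \<partial>?M) \<le> (\<integral>z. ?F w z \<partial>?M) + (\<integral>z. ?F (\<lambda>k. - w k) z \<partial>?M)"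
    by (simp only: Bochner_Integration.integral_add[OF int int])
  then show ?thesis
    unfolding eq[symmetric] by simp
qed

text \<open>Thickness is a reserve of independent noise of variance \<open>c\<close> in every
  coordinate; raising off-diagonal entries is paid for out of it.\<close>

abbreviation thick_cov :: "nat \<Rightarrow> real \<Rightarrow> (nat \<Rightarrow> nat \<Rightarrow> real) \<Rightarrow> bool" where
  "thick_cov n c K \<equiv> gauss_cov n (\<lambda>k l. K k l - (if k = l then c else 0))"

lemma gauss_prod_pair_step:
  assumes K: "thick_cov n c K" and ij: "i < n" "j < n" "i \<noteq> j" and d: "0 \<le> d" "d \<le> c"
    and g: "g \<in> borel_measurable borel" "\<And>x. 0 \<le> g x" "\<And>x. g x \<le> 1" "antimono g"
  defines "L \<equiv> \<lambda>k l. K k l + (if k = i \<and> l = j \<or> k = j \<and> l = i then d else 0)"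
  shows "thick_cov n (c - d) L" "gauss_prod n g K \<le> gauss_prod n g L"
proof -
  let ?e = "\<lambda>c k. if k = i then sqrt c else if k = j then sqrt c else 0"
  let ?f = "\<lambda>c k. if k = i then sqrt c else if k = j then - sqrt c else 0"
  have "gauss_cov n (\<lambda>k l. (K k l - (if k = l then c else 0)) + ?e d k * ?e d l
      + (if k = l then if k = i \<or> k = j then 0 else d else 0))"
    by (intro gauss_cov_add gauss_cov_diag K gauss_cov_rank1) (use d in auto)
  then show "thick_cov n (c - d) L"
    by (rule gauss_cov_cong) (use d ij in \<open>auto simp: L_def\<close>)
  \<comment> \<open>\<open>B\<close> lies midway: it has \<open>d / 2\<close> less on the diagonal
    at \<open>i\<close> and \<open>j\<close>, and \<open>d / 2\<close> more at the pair. Adding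
    \<open>sqrt (d / 2)\<close> times the difference of the two unit vectors gives back
    \<open>K\<close>, adding their sum gives \<open>L\<close>.\<close>
  define B where "B = (\<lambda>k l. (K k l - (if k = l then c else 0)) + ?e (d / 2) k * ?e (d / 2) l
      + (if k = l then if k = i \<or> k = j then c - d else c else 0))"
  have B: "gauss_cov n B"
    unfolding B_def by (intro gauss_cov_add gauss_cov_diag K gauss_cov_rank1) (use d in auto)
  have "(\<lambda>k l. B k l + ?f (d / 2) k * ?f (d / 2) l) = K"
    using d ij by (auto simp: B_def fun_eq_iff)
  moreover have "(\<lambda>k l. B k l + ?e (d / 2) k * ?e (d / 2) l) = L"
    using d ij by (auto simp: B_def L_def fun_eq_iff)
  ultimately show "gauss_prod n g K \<le> gauss_prod n g L"
    using gauss_prod_swap[OF B ij g, of "sqrt (d / 2)"] by simp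
qed

lemma gauss_prod_pairs_step:
  assumes P: "finite P" "P \<subseteq> {(i, j). i < j \<and> j < n}"
    and K: "thick_cov n c K" and D: "\<And>i j. D i j = D j i"
    and m: "\<And>i j. i < j \<Longrightarrow> j < n \<Longrightarrow> 0 \<le> D i j \<and> D i j \<le> m" and c: "real (card P) * m \<le> c" "0 \<le> m"
    and g: "g \<in> borel_measurable borel" "\<And>x. 0 \<le> g x" "\<And>x. g x \<le> 1" "antimono g"
  shows "thick_cov n (c - real (card P) * m) (\<lambda>k l. K k l + (if (min k l, max k l) \<in> P then D k l else 0))
    \<and> gauss_prod n g K \<le> gauss_prod n g (\<lambda>k l. K k l + (if (min k l, max k l) \<in> P then D k l else 0))"
  using P c(1)
proof (induction P rule: finite_induct)
  case empty
  then show ?case using K by (simp cong: if_cong)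
next
  case (insert p P)
  obtain i j where p: "p = (i, j)" "i < j" "j < n" using insert.prems by auto
  let ?K = "\<lambda>k l. K k l + (if (min k l, max k l) \<in> P then D k l else 0)"
  have cP: "real (card (insert p P)) * m = real (card P) * m + m"
    using insert.hyps by (simp add: algebra_simps)
  have IH: "thick_cov n (c - real (card P) * m) ?K" "gauss_prod n g K \<le> gauss_prod n g ?K"
    using insert.IH insert.prems cP c(2) by auto
  have ij: "i < n" "j < n" "i \<noteq> j" and d: "0 \<le> D i j" "D i j \<le> c - real (card P) * m"
    using p m[of i j] insert.prems(2) cP by auto
  have eq: "?K k l + (if k = i \<and> l = j \<or> k = j \<and> l = i then D i j else 0) =
      K k l + (if (min k l, max k l) \<in> insert p P then D k l else 0)" for k l
  proof -
    have "(min k l, max k l) = p \<longleftrightarrow> k = i \<and> l = j \<or> k = j \<and> l = i"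
      using p(2) unfolding p(1) prod.inject min_def max_def by (simp split: if_split) linarith
    moreover have "D k l = D i j" if "k = i \<and> l = j \<or> k = j \<and> l = i" using that D by metis
    ultimately show ?thesis
      using insert.hyps(2) by (cases "(min k l, max k l) = p") auto
  qed
  note st = gauss_prod_pair_step[OF IH(1) ij d g, unfolded eq]
  have "thick_cov n (c - real (card (insert p P)) * m) (\<lambda>k l. K k l + (if (min k l, max k l) \<in> insert p P then D k l else 0))"
  proof (rule gauss_cov_cong[OF gauss_cov_add[OF st(1) gauss_cov_diag[of n "\<lambda>_. m - D i j"]]])
    show "0 \<le> m - D i j" using m[of i j] p by simp
    show "K k l + (if (min k l, max k l) \<in> insert p P then D k l else 0) - (if k = l then c - real (card P) * m - D i j else 0)
        + (if k = l then m - D i j else 0) =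
      K k l + (if (min k l, max k l) \<in> insert p P then D k l else 0) - (if k = l then c - real (card (insert p P)) * m else 0)"
      for k l
      unfolding cP by (cases "k = l") simp_all
  qed
  then show ?case using st(2) IH(2) by auto
qed

lemma gauss_prod_step:
  assumes K: "thick_cov n c K" and D: "\<And>i j. D i j = D j i" "\<And>i. i < n \<Longrightarrow> D i i = 0"
    and m: "\<And>i j. i < j \<Longrightarrow> j < n \<Longrightarrow> 0 \<le> D i j \<and> D i j \<le> m" and c: "real (n * n) * m \<le> c" "0 \<le> m"
    and g: "g \<in> borel_measurable borel" "\<And>x. 0 \<le> g x" "\<And>x. g x \<le> 1" "antimono g"
  shows "gauss_prod n g K \<le> gauss_prod n g (\<lambda>k l. K k l + D k l)"
proof -
  let ?P = "{(i, j). i < j \<and> j < n}"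
  have sub: "?P \<subseteq> {..<n} \<times> {..<n}" by auto
  then have fin: "finite ?P" by (rule finite_subset) auto
  have "card ?P \<le> n * n" using card_mono[OF _ sub] by simp
  then have "real (card ?P) * m \<le> c"
    using c mult_right_mono[of "real (card ?P)" "real (n * n)" m] by linarith
  then have th: "thick_cov n (c - real (card ?P) * m) (\<lambda>k l. K k l + (if (min k l, max k l) \<in> ?P then D k l else 0))"
    and le: "gauss_prod n g K \<le> gauss_prod n g (\<lambda>k l. K k l + (if (min k l, max k l) \<in> ?P then D k l else 0))"
    using gauss_prod_pairs_step[OF fin order_refl K D(1) m _ c(2) g] by auto
  let ?L = "\<lambda>k l. K k l + (if (min k l, max k l) \<in> ?P then D k l else 0)"
  have L: "?L k l = K k l + D k l" if "k < n" "l < n" for k l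
    using that D by (auto simp: min_def max_def)
  have "gauss_cov n ?L"
    by (rule gauss_cov_cong[OF gauss_cov_add[OF th gauss_cov_diag[of n "\<lambda>_. c - real (card ?P) * m"]]])
      (use \<open>real (card ?P) * m \<le> c\<close> in auto)
  then obtain P :: "(nat \<Rightarrow> real) measure" and X where PX: "gauss_vec P n ?L X" unfolding gauss_cov_def by blast
  have "gauss_vec P n (\<lambda>k l. K k l + D k l) X" by (rule gauss_vec_cong[OF PX L])
  from gauss_prod_eq[OF this g(1,2,3)] gauss_prod_eq[OF PX g(1,2,3)] le show ?thesis by simp
qed

text \<open>Slepian's inequality. Along the segment from \<open>K\<close> to \<open>L\<close> the covariance stays thick away from
  \<open>K\<close>, so one can move in small steps, and each step raises one off-diagonal pair at a time by
  turning an independent summand \<open>r Z (e_i - e_j)\<close> into \<open>r Z (e_i + e_j)\<close>.\<close>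

theorem gauss_prod_slepian:
  assumes K: "gauss_cov n K" and L: "thick_cov n c L" "c > 0"
    and sym: "\<And>i j. K i j = K j i" "\<And>i j. L i j = L j i"
    and diag: "\<And>i. i < n \<Longrightarrow> K i i = L i i" and le: "\<And>i j. i < j \<Longrightarrow> j < n \<Longrightarrow> K i j \<le> L i j"
    and g: "continuous_on UNIV g" "\<And>x. 0 \<le> g x" "\<And>x. g x \<le> 1" "antimono g"
  shows "gauss_prod n g K \<le> gauss_prod n g L"
proof -
  have gm[measurable]: "g \<in> borel_measurable borel" using g(1) by (rule borel_measurable_continuous_onI)
  define Kt where "Kt = (\<lambda>t k l. (1 - t) * K k l + t * L k l)"
  define m where "m = (\<Sum>i<n. \<Sum>j<n. \<bar>L i j - K i j\<bar>)"
  have m0: "m \<ge> 0" unfolding m_def by (intro sum_nonneg) auto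
  have m: "\<bar>L i j - K i j\<bar> \<le> m" if "i < n" "j < n" for i j
  proof -
    have "\<bar>L i j - K i j\<bar> \<le> (\<Sum>j<n. \<bar>L i j - K i j\<bar>)" using that by (intro member_le_sum) auto
    also have "\<dots> \<le> m" unfolding m_def using that by (intro member_le_sum[of i "{..<n}" "\<lambda>i. \<Sum>j<n. \<bar>L i j - K i j\<bar>"] sum_nonneg) auto
    finally show ?thesis .
  qed
  have thick: "thick_cov n (t * c) (Kt t)" if "0 \<le> t" "t \<le> 1" for t
    by (rule gauss_cov_cong[OF gauss_cov_add[OF gauss_cov_scale[OF K, of "1 - t"] gauss_cov_scale[OF L(1), of t]]])
      (use that in \<open>auto simp: Kt_def algebra_simps\<close>)
  have step: "gauss_prod n g (Kt t) \<le> gauss_prod n g (Kt (t + h))"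
    if "0 \<le> t" "t \<le> 1" "0 \<le> h" "real (n * n) * (h * m) \<le> t * c" for t h
  proof -
    have "gauss_prod n g (Kt t) \<le> gauss_prod n g (\<lambda>k l. Kt t k l + h * (L k l - K k l))"
    proof (rule gauss_prod_step[OF thick[OF that(1,2)] _ _ _ that(4) _ gm g(2,3,4)])
      show "0 \<le> h * (L i j - K i j) \<and> h * (L i j - K i j) \<le> h * m" if "i < j" "j < n" for i j
        using le[OF that] m[of i j] that \<open>0 \<le> h\<close> by (auto intro!: mult_left_mono mult_nonneg_nonneg)
    qed (use sym diag m0 \<open>0 \<le> h\<close> in auto)
    also have "(\<lambda>k l. Kt t k l + h * (L k l - K k l)) = Kt (t + h)"
      by (auto simp: Kt_def algebra_simps fun_eq_iff)
    finally show ?thesis .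
  qed
  have upper: "gauss_prod n g (Kt t) \<le> gauss_prod n g L" if t: "0 < t" "t < 1" for t
  proof -
    obtain N :: nat where N: "real N > real (n * n) * m / (t * c)" using reals_Archimedean2 by blast
    \<comment> \<open>\<open>Suc N\<close> equal steps lead from \<open>t\<close> to 1, each so
      small that its total price is covered by the thickness \<open>t * c\<close> at the start; the
      thickness only grows along the way.\<close>
    define h where "h = (1 - t) / Suc N"
    have h: "0 \<le> h" using t by (simp add: h_def)
    have "real (n * n) * m < (t * c) * real N" using N t L(2) by (simp add: pos_divide_less_eq mult.commute)
    also have "\<dots> \<le> (t * c) * Suc N" using t L(2) by simp
    finally have NN: "real (n * n) * m \<le> t * c * Suc N" by simp
    have "real (n * n) * (h * m) = (1 - t) * (real (n * n) * m) / Suc N" unfolding h_def by simp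
    also have "\<dots> \<le> (1 - t) * (t * c * Suc N) / Suc N"
      using NN t by (intro divide_right_mono mult_left_mono) auto
    also have "\<dots> \<le> t * c" using t L(2) by (simp add: mult_le_cancel_right1)
    finally have hm: "real (n * n) * (h * m) \<le> t * c" .
    have "gauss_prod n g (Kt t) \<le> gauss_prod n g (Kt (t + real k * h))" if "k \<le> Suc N" for k
      using that
    proof (induction k)
      case (Suc k)
      have "real k * h \<le> real (Suc N) * h" using Suc.prems h by (intro mult_right_mono) auto
      then have b: "t + real k * h \<le> 1" by (simp add: h_def)
      have "t * c \<le> (t + real k * h) * c" using h L(2) by (intro mult_right_mono) auto
      then have "gauss_prod n g (Kt (t + real k * h)) \<le> gauss_prod n g (Kt (t + real k * h + h))"
        using b h t hm by (intro step) auto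
      then show ?case using Suc by (simp add: algebra_simps)
    qed simp
    from this[of "Suc N"] have "gauss_prod n g (Kt t) \<le> gauss_prod n g (Kt 1)" by (simp add: h_def)
    then show ?thesis by (simp add: Kt_def)
  qed
  have "gauss_cov n L"
    by (rule gauss_cov_cong[OF gauss_cov_add[OF L(1) gauss_cov_diag[of n "\<lambda>_. c"]]]) (use L(2) in auto)
  then obtain P Q :: "(nat \<Rightarrow> real) measure" and X Y where P: "gauss_vec P n K X" and Q: "gauss_vec Q n L Y"
    using K unfolding gauss_cov_def by blast
  \<comment> \<open>At \<open>t = 0\<close> the interpolation gives no positive thickness, so no
    step can start there. A coupling of all \<open>Kt t\<close> on one space makes the product
    continuous in \<open>t\<close>, and dominated convergence passes to the limit along
    \<open>1 / (k + 2)\<close>.\<close>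
  let ?M = "P \<Otimes>\<^sub>M Q"
  let ?F = "\<lambda>t z. \<Prod>k<n. g (sqrt (1 - t) * X k (fst z) + sqrt t * Y k (snd z))"
  have V: "gauss_vec ?M n (Kt t) (\<lambda>k z. sqrt (1 - t) * X k (fst z) + sqrt t * Y k (snd z))" if "0 \<le> t" "t \<le> 1" for t
    by (rule gauss_vec_cong[OF gauss_vec_sum[OF gauss_vec_coord_scale[OF P, of "\<lambda>_. sqrt (1 - t)"]
            gauss_vec_coord_scale[OF Q, of "\<lambda>_. sqrt t"]]])
      (use that in \<open>auto simp: Kt_def\<close>)
  have eq: "gauss_prod n g (Kt t) = (\<integral>z. ?F t z \<partial>?M)" if "0 \<le> t" "t \<le> 1" for t
    using gauss_prod_eq[OF V[OF that] gm g(2,3)] by simp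
  interpret M: prob_space ?M using gauss_vecD(1)[OF V[of 0]] by simp
  note [measurable] = gauss_vecD(2)[OF P] gauss_vecD(2)[OF Q]
  let ?s = "\<lambda>k. inverse (real (Suc (Suc k)))"
  have s0: "(\<lambda>k. ?s k) \<longlonglongrightarrow> 0" using LIMSEQ_Suc[OF LIMSEQ_inverse_real_of_nat] .
  have s1: "?s k < 1" for k by (simp add: inverse_less_1_iff)
  have "(\<lambda>k. \<integral>z. ?F (?s k) z \<partial>?M) \<longlonglongrightarrow> (\<integral>z. ?F 0 z \<partial>?M)"
  proof (rule integral_dominated_convergence[where w = "\<lambda>_. 1"])
    show "AE z in ?M. (\<lambda>k. ?F (?s k) z) \<longlonglongrightarrow> ?F 0 z"
    proof (rule AE_I2, rule tendsto_prod)
      fix z k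
      have "isCont g (sqrt (1 - 0) * X k (fst z) + sqrt 0 * Y k (snd z))"
        using g(1) by (simp add: continuous_on_eq_continuous_at)
      then show "(\<lambda>i. g (sqrt (1 - ?s i) * X k (fst z) + sqrt (?s i) * Y k (snd z)))
          \<longlonglongrightarrow> g (sqrt (1 - 0) * X k (fst z) + sqrt 0 * Y k (snd z))"
        by (rule isCont_tendsto_compose) (intro tendsto_intros s0)
    qed
    show "AE z in ?M. norm (?F (?s k) z) \<le> 1" for k
      using g by (auto simp: abs_of_nonneg prod_nonneg intro!: prod_le_1)
  qed auto
  then have lim: "(\<lambda>k. gauss_prod n g (Kt (?s k))) \<longlonglongrightarrow> gauss_prod n g (Kt 0)"
    using s1 by (simp add: eq less_imp_le)
  have "gauss_prod n g (Kt 0) \<le> gauss_prod n g L"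
    by (rule LIMSEQ_le_const2[OF lim]) (use upper s1 in auto)
  then show ?thesis by (simp add: Kt_def)
qed

section \<open>Gaussian tails and stationary Gaussian processes\<close>

lemma prob_space_std_normal: "prob_space std_normal_distribution"
  using real_dist_normal_dist by (simp add: real_distribution_def)

lemma std_normal_exp:
  "integrable std_normal_distribution (\<lambda>z. exp (l * z))"
  "(\<integral>z. exp (l * z) \<partial>std_normal_distribution) = exp (l\<^sup>2 / 2)"
proof -
  have eq: "std_normal_density z *\<^sub>R exp (l * z) = exp (l\<^sup>2 / 2) * normal_density l 1 z" for z
  proof -
    have "exp (- z\<^sup>2 / 2) * exp (l * z) = exp (l\<^sup>2 / 2) * exp (- (z - l)\<^sup>2 / 2)"
      unfolding exp_add[symmetric] by (simp add: power2_eq_square algebra_simps add_divide_distrib diff_divide_distrib)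
    then show ?thesis by (simp add: normal_density_def)
  qed
  show "integrable std_normal_distribution (\<lambda>z. exp (l * z))"
    by (subst integrable_density) (auto simp only: eq[unfolded real_scaleR_def] real_scaleR_def intro!: integrable_mult_right integrable_normal_density, auto)
  show "(\<integral>z. exp (l * z) \<partial>std_normal_distribution) = exp (l\<^sup>2 / 2)"
    by (subst integral_density) (simp_all only: eq integral_mult_right_zero, auto)
qed

text \<open>With \<open>\<tau> = 0\<close> allowed, point masses and densities take the same form,
  so moments and transforms can be computed once from the standard normal law.\<close>

lemma gaussian_rv_distr_std_normal:
  assumes M: "prob_space M" and Y: "gaussian_rv M Y" and E: "(\<integral>x. Y x \<partial>M) = 0"
  obtains \<tau> where "\<tau> \<ge> 0" "distr M borel Y = distr std_normal_distribution borel (\<lambda>z. \<tau> * z)"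
proof -
  interpret prob_space M by fact
  interpret S: prob_space std_normal_distribution by (rule prob_space_std_normal)
  have Ym[measurable]: "Y \<in> borel_measurable M" using Y by (simp add: gaussian_rv_def)
  from Y consider \<mu> \<tau> where "\<tau> > 0" "distributed M lborel Y (normal_density \<mu> \<tau>)"
    | \<mu> where "AE x in M. Y x = \<mu>" unfolding gaussian_rv_def by blast
  then show thesis
  proof cases
    case 1
    have "\<mu> = 0" using normal_distributed_expectation[OF 1] E by simp
    then have "distributed M lborel (\<lambda>x. Y x / \<tau>) std_normal_density"
      using normal_standard_normal_convert[OF 1(1), of Y \<mu>] 1(2) by simp
    then have "distr M lborel (\<lambda>x. Y x / \<tau>) = std_normal_distribution"
      by (rule distributed_distr_eq_density)
    then have "distr (distr M lborel (\<lambda>x. Y x / \<tau>)) borel (\<lambda>z. \<tau> * z) = distr std_normal_distribution borel (\<lambda>z. \<tau> * z)"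
      by simp
    then have "distr M borel Y = distr std_normal_distribution borel (\<lambda>z. \<tau> * z)"
      using 1(1) by (subst (asm) distr_distr) (auto simp: o_def)
    then show ?thesis using that[of \<tau>] 1(1) by simp
  next
    case 2
    have "(\<integral>x. Y x \<partial>M) = (\<integral>x. \<mu> \<partial>M)" using 2 by (intro integral_cong_AE) auto
    then have "\<mu> = 0" using E by (simp add: prob_space)
    have "distr M borel Y = distr M borel (\<lambda>_. 0)"
      using 2 \<open>\<mu> = 0\<close> by (intro distr_cong_AE) auto
    also have "\<dots> = distr std_normal_distribution borel (\<lambda>z. 0 * z)"
      by (simp add: distr_const S.distr_const)
    finally show ?thesis using that[of 0] by simp
  qed
qed

lemma centered_gaussian_rv:
  assumes M: "prob_space M" and Y: "gaussian_rv M Y" and E: "(\<integral>x. Y x \<partial>M) = 0"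
  shows "integrable M Y" "integrable M (\<lambda>x. (Y x)\<^sup>2)"
    and "(CLINT x|M. iexp (Y x)) = complex_of_real (exp (- (\<integral>x. (Y x)\<^sup>2 \<partial>M) / 2))"
    and "integrable M (\<lambda>x. exp (l * Y x))" "(\<integral>x. exp (l * Y x) \<partial>M) = exp (l\<^sup>2 * (\<integral>x. (Y x)\<^sup>2 \<partial>M) / 2)"
proof -
  obtain \<tau> where t: "\<tau> \<ge> 0" and D: "distr M borel Y = distr std_normal_distribution borel (\<lambda>z. \<tau> * z)"
    by (rule gaussian_rv_distr_std_normal[OF assms])
  have Ym[measurable]: "Y \<in> borel_measurable M" using Y by (simp add: gaussian_rv_def)
  have I: "integrable M (\<lambda>x. f (Y x)) \<longleftrightarrow> integrable std_normal_distribution (\<lambda>z. f (\<tau> * z))"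
    and L: "(\<integral>x. f (Y x) \<partial>M) = (\<integral>z. f (\<tau> * z) \<partial>std_normal_distribution)"
    if [measurable]: "f \<in> borel_measurable borel" for f :: "real \<Rightarrow> 'c::{banach, second_countable_topology}"
    using integrable_distr_eq[OF Ym that] integrable_distr_eq[of "\<lambda>z. \<tau> * z" std_normal_distribution borel f]
      integral_distr[OF Ym that] integral_distr[of "\<lambda>z. \<tau> * z" std_normal_distribution borel f]
    unfolding D by simp_all
  show "integrable M Y" using I[of "\<lambda>y. y"] integrable_std_normal_distribution_moment[of 1] by simp
  have sq: "(\<integral>x. (Y x)\<^sup>2 \<partial>M) = \<tau>\<^sup>2"
    using L[of "\<lambda>y. y\<^sup>2"] std_normal_distribution_even_moments(1)[of 1] by (simp add: power_mult_distrib)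
  show "integrable M (\<lambda>x. (Y x)\<^sup>2)"
    using I[of "\<lambda>y. y\<^sup>2"] integrable_std_normal_distribution_moment[of 2] by (simp add: power_mult_distrib)
  show "(CLINT x|M. iexp (Y x)) = complex_of_real (exp (- (\<integral>x. (Y x)\<^sup>2 \<partial>M) / 2))"
    using L[of iexp] fun_cong[OF char_std_normal_distribution, of \<tau>] unfolding sq char_def by simp
  show "integrable M (\<lambda>x. exp (l * Y x))"
    using I[of "\<lambda>y. exp (l * y)"] std_normal_exp(1)[of "l * \<tau>"] by (simp add: mult.assoc)
  show "(\<integral>x. exp (l * Y x) \<partial>M) = exp (l\<^sup>2 * (\<integral>x. (Y x)\<^sup>2 \<partial>M) / 2)"
    using L[of "\<lambda>y. exp (l * y)"] std_normal_exp(2)[of "l * \<tau>"] unfolding sq by (simp add: mult.assoc power_mult_distrib)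
qed

text \<open>Exponential Markov bound with the optimal parameter \<open>x\<close>.\<close>

lemma std_normal_lower_tail:
  assumes "x \<ge> 0"
  shows "measure std_normal_distribution {..< - x} \<le> exp (- x\<^sup>2 / 2)"
proof -
  interpret S: prob_space std_normal_distribution by (rule prob_space_std_normal)
  have "measure std_normal_distribution {..< - x} = (\<integral>z. indicator {..< - x} z \<partial>std_normal_distribution)" by simp
  also have "\<dots> \<le> (\<integral>z. exp (- x\<^sup>2) * exp (- x * z) \<partial>std_normal_distribution)"
  proof (rule integral_mono)
    fix z
    show "indicator {..< - x} z \<le> exp (- x\<^sup>2) * exp (- x * z)"
      unfolding exp_add[symmetric]
    proof (cases "z < - x")
      case True
      have "x * z \<le> x * - x" using True assms by (intro mult_left_mono) auto
      then show "indicator {..< - x} z \<le> exp (- x\<^sup>2 + - x * z)" using True by (simp add: power2_eq_square)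
    qed auto
    show "integrable std_normal_distribution (\<lambda>z. exp (- x\<^sup>2) * exp (- x * z))"
      by (intro integrable_mult_right std_normal_exp(1))
  qed (auto intro!: S.integrable_const_bound[where B = 1])
  also have "\<dots> = exp (- x\<^sup>2) * exp (x\<^sup>2 / 2)"
    by (simp add: std_normal_exp(2)[of "- x", simplified])
  also have "\<dots> = exp (- x\<^sup>2 / 2)" unfolding exp_add[symmetric] by simp
  finally show ?thesis .
qed

text \<open>The mass beyond \<open>W\<close> is at least that of the strip of width
  \<open>h\<close>, where the density is smallest at the right end. The exponential form is chosen
  because \<open>n\<close> independent coordinates then contribute a factor \<open>n\<close> in the
  exponent.\<close>

lemma std_normal_upper_tail:
  assumes "W \<ge> 0" "h > 0"
  shows "measure std_normal_distribution {..<W} \<le> exp (- (h * std_normal_density (W + h)))"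
proof -
  interpret S: prob_space std_normal_distribution by (rule prob_space_std_normal)
  have "h * std_normal_density (W + h) = (\<integral>z. std_normal_density (W + h) * indicator {W..W + h} z \<partial>lborel)"
    using assms by simp
  also have "\<dots> \<le> (\<integral>z. std_normal_density z * indicator {W..W + h} z \<partial>lborel)"
  proof (rule integral_mono)
    show "integrable lborel (\<lambda>z. std_normal_density (W + h) * indicator {W..W + h} z)"
      by (intro integrable_mult_right integrable_real_indicator) (auto simp: emeasure_lborel_Icc_eq)
    show "integrable lborel (\<lambda>z. std_normal_density z * indicator {W..W + h} z)"
      by (rule integrable_mult_indicator[where 'b = real, simplified mult.commute real_scaleR_def]) auto
    show "std_normal_density (W + h) * indicator {W..W + h} z \<le> std_normal_density z * indicator {W..W + h} z" for z
      using assms by (auto simp: indicator_def std_normal_density_def intro!: divide_right_mono power_mono)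
  qed
  also have "\<dots> = (\<integral>z. indicator {W..W + h} z \<partial>std_normal_distribution)"
    by (subst integral_density) auto
  also have "\<dots> = measure std_normal_distribution {W..W + h}" by simp
  also have "\<dots> \<le> measure std_normal_distribution (UNIV - {..<W})"
    by (rule S.finite_measure_mono) auto
  also have "\<dots> = 1 - measure std_normal_distribution {..<W}"
    using S.prob_compl[of "{..<W}"] by simp
  finally have "measure std_normal_distribution {..<W} \<le> 1 + (- (h * std_normal_density (W + h)))" by simp
  also have "\<dots> \<le> exp (- (h * std_normal_density (W + h)))" by (rule exp_ge_add_one_self)
  finally show ?thesis .
qed

section \<open>Comparison with an equicorrelated vector\<close>

lemma measure_pair_Times:
  assumes "prob_space M2" "A \<in> sets M1" "B \<in> sets M2"
  shows "measure (M1 \<Otimes>\<^sub>M M2) (A \<times> B) = measure M1 A * measure M2 B"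
proof -
  interpret prob_space M2 by fact
  show ?thesis using assms by (simp add: measure_def emeasure_pair_measure_Times enn2real_mult)
qed

text \<open>Coordinates \<open>sqrt \<kappa> Z + sqrt (v - \<kappa>) Z_j\<close> have variance \<open>v\<close> and pairwise covariance \<open>\<kappa>\<close>; the bound
  separates the event that the common part is below \<open>- sqrt \<kappa> x\<close>.\<close>

lemma gauss_vec_all_le:
  assumes G: "gauss_vec M n K X"
    and K: "\<And>i j. K i j = K j i" "\<And>i. i < n \<Longrightarrow> K i i = v" "\<And>i j. i < j \<Longrightarrow> j < n \<Longrightarrow> K i j \<le> \<kappa>"
    and \<kappa>: "0 \<le> \<kappa>" "\<kappa> < v" and u: "u < u'" and x: "0 \<le> x"
    and W: "u' + sqrt \<kappa> * x \<le> W * sqrt (v - \<kappa>)" "0 \<le> W" and h: "h > 0"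
  shows "measure M {z \<in> space M. \<forall>j<n. X j z \<le> u} \<le>
    exp (- x\<^sup>2 / 2) + exp (- (real n * (h * std_normal_density (W + h))))"
proof -
  interpret M: prob_space M by (rule gauss_vecD[OF G])
  interpret S: prob_space std_normal_distribution by (rule prob_space_std_normal)
  interpret I: product_prob_space "\<lambda>j. std_normal_distribution" "{..<n}" ..
  interpret IF: finite_product_prob_space "\<lambda>j. std_normal_distribution" "{..<n}" by standard auto
  let ?N = "\<Pi>\<^sub>M j\<in>{..<n}. std_normal_distribution"
  let ?Q = "std_normal_distribution \<Otimes>\<^sub>M ?N"
  interpret Q: pair_prob_space std_normal_distribution ?N ..
  note [measurable] = gauss_vecD(2)[OF G]
  define c where "c = sqrt (v - \<kappa>)"
  have c: "c > 0" using \<kappa> by (simp add: c_def)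
  define L where "L = (\<lambda>i j::nat. \<kappa> + (if i = j then v - \<kappa> else 0))"
  define Y where "Y = (\<lambda>(j::nat) z. sqrt \<kappa> * fst z + c * snd z j)"
  have Y: "gauss_vec ?Q n L Y"
    unfolding Y_def L_def
    by (rule gauss_vec_cong[OF gauss_vec_sum[OF gauss_vec_rank1[of n "\<lambda>_. sqrt \<kappa>"]
            gauss_vec_coord_scale[OF gauss_vec_iid, of n "\<lambda>_. c"]]])
      (use \<kappa> in \<open>auto simp: c_def\<close>)
  note [measurable] = gauss_vecD(2)[OF Y]
  \<comment> \<open>Slepian's inequality is available for continuous \<open>g\<close>, so the
    indicator of the half-line is replaced by a linear ramp from 1 at \<open>u\<close> to 0 at
    \<open>u'\<close>; this is why two levels occur.\<close>
  define g where "g = (\<lambda>y. min 1 (max 0 ((u' - y) / (u' - u))))"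
  have g: "continuous_on UNIV g" "\<And>y. 0 \<le> g y" "\<And>y. g y \<le> 1" "antimono g"
    using u by (auto simp: g_def antimono_def intro!: continuous_intros min.coboundedI2 max.mono divide_right_mono)
  have gm[measurable]: "g \<in> borel_measurable borel" using g(1) by (rule borel_measurable_continuous_onI)
  have g1: "g y = 1" if "y \<le> u" for y using that u by (simp add: g_def min_def max_def field_simps)
  have g0: "g y = 0" if "y \<ge> u'" for y
    using divide_nonpos_pos[of "u' - y" "u' - u"] that u by (simp add: g_def)
  have "measure M {z \<in> space M. \<forall>j<n. X j z \<le> u} = (\<integral>z. indicator {z \<in> space M. \<forall>j<n. X j z \<le> u} z \<partial>M)"
    by simp
  also have "\<dots> \<le> (\<integral>z. (\<Prod>j<n. g (X j z)) \<partial>M)"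
    by (rule integral_mono)
      (auto simp: indicator_def g1 abs_of_nonneg g(2,3) prod_nonneg intro!: M.integrable_const_bound[where B = 1] AE_I2 prod_le_1)
  also have "\<dots> = gauss_prod n g K" by (rule gauss_prod_eq[OF G gm g(2,3)])
  also have "\<dots> \<le> gauss_prod n g L"
  proof (rule gauss_prod_slepian[OF gauss_covI[OF G] _ _ K(1) _ _ _ g])
    show "thick_cov n (v - \<kappa>) L"
      by (rule gauss_cov_cong[OF gauss_cov_rank1[of n "\<lambda>_. sqrt \<kappa>"]]) (use \<kappa> in \<open>auto simp: L_def\<close>)
  qed (use \<kappa> K in \<open>auto simp: L_def\<close>)
  also have "\<dots> = (\<integral>z. (\<Prod>j<n. g (Y j z)) \<partial>?Q)" by (rule gauss_prod_eq[OF Y gm g(2,3), symmetric])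
  also have "\<dots> \<le> (\<integral>z. indicator ({..< - x} \<times> space ?N) z + indicator (UNIV \<times> (\<Pi>\<^sub>E j\<in>{..<n}. {..<W})) z \<partial>?Q)"
  proof (rule integral_mono)
    fix z assume z: "z \<in> space ?Q"
    show "(\<Prod>j<n. g (Y j z)) \<le> indicator ({..< - x} \<times> space ?N) z + indicator (UNIV \<times> (\<Pi>\<^sub>E j\<in>{..<n}. {..<W})) z"
    \<comment> \<open>A nonzero product forces every \<open>Y j\<close> below \<open>u'\<close>.
      Unless the common normal is below \<open>- x\<close>, it can pull a coordinate down by at most
      \<open>sqrt \<kappa> * x\<close>, so every independent normal is below
      \<open>W\<close>.\<close>
    proof (cases "\<forall>j<n. Y j z < u'")
      case True
      have le: "(\<Prod>j<n. g (Y j z)) \<le> 1" using g by (auto intro!: prod_le_1)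
      show ?thesis
      proof (cases "fst z < - x")
        case True
        then have "z \<in> {..< - x} \<times> space ?N" using z by (auto simp: space_pair_measure)
        then show ?thesis using le by (simp add: indicator_def)
      next
        case False
        have "snd z j < W" if "j < n" for j
        proof -
          have "sqrt \<kappa> * - x \<le> sqrt \<kappa> * fst z" using False \<kappa> by (intro mult_left_mono) auto
          then have "c * snd z j < c * W" using True that W unfolding Y_def c_def by (auto simp: mult.commute)
          then show ?thesis using c by simp
        qed
        then have "z \<in> UNIV \<times> (\<Pi>\<^sub>E j\<in>{..<n}. {..<W})"
          using z by (auto simp: space_pair_measure space_PiM PiE_iff extensional_def)
        then show ?thesis using le by (simp add: indicator_def)
      qed
    next
      case False
      then obtain j where "j < n" "u' \<le> Y j z" by (auto simp: not_less)
      then have "\<exists>j\<in>{..<n}. g (Y j z) = 0" using g0 by auto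
      then have "(\<Prod>j<n. g (Y j z)) = 0" by (intro prod_zero) auto
      then show ?thesis by (simp only: add_nonneg_nonneg indicator_pos_le)
    qed
  next
    show "integrable ?Q (\<lambda>z. \<Prod>j<n. g (Y j z))"
      by (rule Q.integrable_const_bound[where B = 1])
        (auto simp: abs_of_nonneg g(2,3) prod_nonneg intro!: AE_I2 prod_le_1)
    show "integrable ?Q (\<lambda>z. indicator ({..< - x} \<times> space ?N) z + indicator (UNIV \<times> (\<Pi>\<^sub>E j\<in>{..<n}. {..<W})) z :: real)"
      by (intro Bochner_Integration.integrable_add Q.integrable_const_bound[where B = 1]
          borel_measurable_indicator pair_measureI sets_PiM_I_finite) auto
  qed
  also have "\<dots> = measure ?Q ({..< - x} \<times> space ?N) + measure ?Q (UNIV \<times> (\<Pi>\<^sub>E j\<in>{..<n}. {..<W}))"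
  proof -
    have s: "{..< - x} \<times> space ?N \<in> sets ?Q" "UNIV \<times> (\<Pi>\<^sub>E j\<in>{..<n}. {..<W}) \<in> sets ?Q"
      by (auto intro!: pair_measureI sets_PiM_I_finite)
    have sp: "A \<inter> space ?Q = A" if "A \<in> sets ?Q" for A using sets.sets_into_space[OF that] by auto
    show ?thesis using s
      by (subst Bochner_Integration.integral_add)
        (auto intro!: Q.integrable_const_bound[where B = 1] simp: sp)
  qed
  also have "measure ?Q ({..< - x} \<times> space ?N) = measure std_normal_distribution {..< - x}"
    by (subst measure_pair_Times) (auto simp: prob_space.prob_space[OF I.P.prob_space_axioms] intro: I.P.prob_space_axioms)
  also have "measure ?Q (UNIV \<times> (\<Pi>\<^sub>E j\<in>{..<n}. {..<W})) = measure std_normal_distribution {..<W} ^ n"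
    using S.prob_space by (subst measure_pair_Times) (auto simp: IF.prob_times intro!: sets_PiM_I_finite I.prob_space_axioms)
  also have "measure std_normal_distribution {..<W} ^ n \<le> exp (- (h * std_normal_density (W + h))) ^ n"
    by (intro power_mono std_normal_upper_tail W h) auto
  also have "exp (- (h * std_normal_density (W + h))) ^ n = exp (- (real n * (h * std_normal_density (W + h))))"
    by (simp flip: exp_of_nat_mult)
  finally show ?thesis using std_normal_lower_tail[OF x] by simp
qed

section \<open>Estimates for maxima and expectations\<close>

text \<open>Sums the chaining increments: \<open>q ^ k\<close> is the decay of the standard
  deviation per doubling, and the linear factor is the growth of the logarithm of the number of
  increments. Two differencings collapse the sum.\<close>

lemma sum_Suc_power_le:
  fixes q :: real
  assumes "0 < q" "q < 1"
  shows "(\<Sum>k<K. real (Suc k) * q ^ k) \<le> 1 / (1 - q)\<^sup>2"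
proof -
  have "(1 - q)\<^sup>2 * (\<Sum>k<K. real (Suc k) * q ^ k) = 1 - real (Suc K) * q ^ K + real K * q ^ Suc K"
    by (induction K) (simp_all add: power2_eq_square algebra_simps)
  also have "real K * q ^ Suc K \<le> real (Suc K) * q ^ K"
    using assms by (intro mult_mono power_decreasing) auto
  finally have "(\<Sum>k<K. real (Suc k) * q ^ k) * (1 - q)\<^sup>2 \<le> 1" by (simp add: mult.commute)
  then show ?thesis using assms by (simp add: pos_le_divide_eq)
qed

context prob_space
begin

lemma AE_equal_prob_subset:
  assumes "A \<in> events" "B \<in> events" "A \<subseteq> B" "prob A = prob B"
  shows "AE x in M. x \<in> A \<longleftrightarrow> x \<in> B"
proof -
  have "prob (B - A) = 0" using assms finite_measure_Diff[of B A] by simp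
  then have "AE x in M. x \<notin> B - A"
    using assms by (intro AE_not_in) (auto simp: emeasure_eq_measure null_sets_def)
  then show ?thesis using assms(3) by (auto elim!: AE_mp)
qed

text \<open>Jensen's inequality through the tangent of the exponential at the mean.\<close>

lemma exp_expectation_le:
  fixes Z :: "'a \<Rightarrow> real"
  assumes "integrable M Z" "integrable M (\<lambda>x. exp (Z x))"
  shows "exp (expectation Z) \<le> expectation (\<lambda>x. exp (Z x))"
proof -
  let ?m = "expectation Z"
  have "exp ?m = expectation (\<lambda>x. exp ?m * (1 + (Z x - ?m)))" using assms by (simp add: prob_space)
  also have "\<dots> \<le> expectation (\<lambda>x. exp (Z x))"
  proof (rule integral_mono)
    fix x
    have "exp ?m * (1 + (Z x - ?m)) \<le> exp ?m * exp (Z x - ?m)"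
      using exp_ge_add_one_self[of "Z x - ?m"] by (intro mult_left_mono) auto
    then show "exp ?m * (1 + (Z x - ?m)) \<le> exp (Z x)" by (simp flip: exp_add)
  qed (use assms in auto)
  finally show ?thesis .
qed

lemma expectation_MAX_le:
  fixes Y :: "'i \<Rightarrow> 'a \<Rightarrow> real"
  assumes I: "finite I" "I \<noteq> {}" and Y: "\<And>i. i \<in> I \<Longrightarrow> integrable M (Y i)"
    and eY: "\<And>i. i \<in> I \<Longrightarrow> integrable M (\<lambda>x. exp (l * Y i x))" "\<And>i. i \<in> I \<Longrightarrow> expectation (\<lambda>x. exp (l * Y i x)) \<le> B"
    and l: "l > 0" and B: "B > 0"
  shows "expectation (\<lambda>x. MAX i\<in>I. Y i x) \<le> ln (real (card I) * B) / l"
proof -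
  \<comment> \<open>The tangent inequality \<open>y \<le> c - 1 + exp (y - c)\<close> is applied to
    \<open>l\<close> times the maximum, with the exponential bounded by the sum over
    \<open>I\<close>. This \<open>c\<close> gives that sum, scaled by \<open>exp (- c)\<close>,
    expectation at most 1, which cancels the \<open>- 1\<close>.\<close>
  define c where "c = ln (real (card I) * B)"
  have cB: "exp c = real (card I) * B" using I B by (simp add: c_def card_gt_0_iff)
  have int: "integrable M (\<lambda>x. (c - 1 + exp (- c) * (\<Sum>i\<in>I. exp (l * Y i x))) / l)"
    by (intro integrable_divide Bochner_Integration.integrable_add integrable_mult_right Bochner_Integration.integrable_sum eY(1) integrable_const)
  have "expectation (\<lambda>x. MAX i\<in>I. Y i x) \<le> expectation (\<lambda>x. (c - 1 + exp (- c) * (\<Sum>i\<in>I. exp (l * Y i x))) / l)"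
  proof (rule integral_mono[OF integrable_MAX[OF I Y] int])
    fix x
    have "(MAX i\<in>I. Y i x) \<in> (\<lambda>i. Y i x) ` I" using I by (intro Max_in) auto
    then obtain j where j: "(MAX i\<in>I. Y i x) = Y j x" "j \<in> I" by (rule imageE)
    have "l * Y j x \<le> c - 1 + exp (l * Y j x - c)" using exp_ge_add_one_self[of "l * Y j x - c"] by linarith
    also have "exp (l * Y j x - c) = exp (- c) * exp (l * Y j x)" by (simp flip: exp_add)
    also have "exp (l * Y j x) \<le> (\<Sum>i\<in>I. exp (l * Y i x))" using j I by (intro member_le_sum) auto
    finally show "(MAX i\<in>I. Y i x) \<le> (c - 1 + exp (- c) * (\<Sum>i\<in>I. exp (l * Y i x))) / l"
      using l unfolding j(1) by (simp add: pos_le_divide_eq mult.commute)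
  qed
  also have "\<dots> = (c - 1 + exp (- c) * (\<Sum>i\<in>I. expectation (\<lambda>x. exp (l * Y i x)))) / l"
    using eY(1) by (simp add: prob_space Bochner_Integration.integral_sum)
  also have "\<dots> \<le> (c - 1 + exp (- c) * (\<Sum>i\<in>I. B)) / l"
    using eY(2) l by (intro divide_right_mono add_left_mono mult_left_mono sum_mono) auto
  also have "\<dots> = c / l" unfolding sum_constant cB[symmetric] by (simp flip: exp_add)
  finally show ?thesis by (simp add: c_def)
qed

end

section \<open>Stationary Gaussian processes\<close>

locale stationary_gaussian = prob_space M for M :: "'a measure" +
  fixes V :: "real \<Rightarrow> 'a \<Rightarrow> real" and \<sigma> :: real
  assumes gaussian: "gaussian_process M V"
    and centered: "centered_process M V"
    and stationary: "stationary_process M V"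
    and cont_paths: "continuous_sample_paths M V"
    and sigma: "\<sigma> > 0"
    and variance: "\<And>t. variance (V t) = \<sigma>\<^sup>2"
begin

abbreviation "R \<equiv> R_cov M V"

lemma V_measurable[measurable]: "V t \<in> borel_measurable M"
  using gaussian by (simp add: gaussian_process_def)

lemma expectation_V: "expectation (V t) = 0"
  using centered by (simp add: centered_process_def)

lemma gaussian_rv_V: "gaussian_rv M (V t)"
  using gaussian[unfolded gaussian_process_def, THEN conjunct2, rule_format, of "{t}" "\<lambda>_. 1"] by simp

lemma V_integrable: "integrable M (V t)" "integrable M (\<lambda>x. (V t x)\<^sup>2)"
  using centered_gaussian_rv[OF prob_space_axioms gaussian_rv_V expectation_V] by auto

lemma expectation_V_square: "expectation (\<lambda>x. (V t x)\<^sup>2) = \<sigma>\<^sup>2"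
  using variance[of t] by (simp add: expectation_V)

lemma V_exp: "integrable M (\<lambda>x. exp (l * V t x))" "expectation (\<lambda>x. exp (l * V t x)) = exp (l\<^sup>2 * \<sigma>\<^sup>2 / 2)"
  using centered_gaussian_rv(4,5)[OF prob_space_axioms gaussian_rv_V[of t] expectation_V, of l]
  by (auto simp: expectation_V_square)

lemma VV_integrable: "integrable M (\<lambda>x. V s x * V t x)"
proof (rule Bochner_Integration.integrable_bound)
  show "integrable M (\<lambda>x. (V s x)\<^sup>2 + (V t x)\<^sup>2)" by (intro Bochner_Integration.integrable_add V_integrable)
  have "\<bar>a * b\<bar> \<le> a\<^sup>2 + b\<^sup>2" for a b :: real
    using sum_squares_bound[of "\<bar>a\<bar>" "\<bar>b\<bar>"] abs_ge_zero[of "a * b"] unfolding abs_mult power2_abs by linarith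
  then show "AE x in M. norm (V s x * V t x) \<le> norm ((V s x)\<^sup>2 + (V t x)\<^sup>2)" by auto
qed auto

lemma path_shift_measurable[measurable]: "path_shift V s \<in> measurable M path_space"
  unfolding path_shift_def by (rule measurable_PiM_single') auto

lemma expectation_VV: "expectation (\<lambda>x. V s x * V t x) = R (t - s)"
proof -
  \<comment> \<open>Stationarity equates laws on path space, so the product of two values is read as
    a functional of the shifted path.\<close>
  have [measurable]: "(\<lambda>f. f 0 * f (t - s)) \<in> borel_measurable path_space"
    by (intro borel_measurable_times measurable_component_singleton) auto
  have E: "(\<integral>f. f 0 * f (t - s) \<partial>distr M path_space (path_shift V r)) =
      expectation (\<lambda>x. V r x * V (t - s + r) x)" for r
    by (subst integral_distr) (auto simp: path_shift_def)
  have "expectation (\<lambda>x. V s x * V t x) = (\<integral>f. f 0 * f (t - s) \<partial>distr M path_space (path_shift V s))"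
    by (simp add: E)
  also have "\<dots> = (\<integral>f. f 0 * f (t - s) \<partial>distr M path_space (path_shift V 0))"
    by (rule arg_cong[OF stationary[unfolded stationary_process_def, rule_format]])
  also have "\<dots> = R (t - s)"
    by (simp only: E R_cov_def covariance_def expectation_V diff_zero add_0_right)
  finally show ?thesis .
qed

lemma R_0: "R 0 = \<sigma>\<^sup>2"
  using expectation_VV[of 0 0] expectation_V_square[of 0] by (simp add: power2_eq_square)

lemma R_minus: "R (- t) = R t"
  using expectation_VV[of t 0] expectation_VV[of 0 t] by (simp add: mult.commute[of "V t _"])

text \<open>\<open>gaussian_process\<close> speaks of finite sets of times, while an indexed family
  may repeat a time; coefficients of equal times are collected.\<close>

lemma gaussian_rv_sum: "gaussian_rv M (\<lambda>x. \<Sum>j<n. a j * V (t j) x)" for n :: nat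
proof -
  let ?b = "\<lambda>s. \<Sum>j\<in>{j\<in>{..<n}. t j = s}. a j"
  have "(\<Sum>j<n. a j * V (t j) x) = (\<Sum>s\<in>t ` {..<n}. ?b s * V s x)" for x
    by (subst sum.image_gen[OF finite_lessThan, of _ _ t]) (auto simp: sum_distrib_right intro!: sum.cong)
  then show ?thesis
    using gaussian unfolding gaussian_process_def by auto
qed

lemma expectation_sum: "expectation (\<lambda>x. \<Sum>j<n. a j * V (t j) x) = 0" for n :: nat
  by (subst Bochner_Integration.integral_sum) (auto simp: expectation_V intro!: integrable_mult_right V_integrable)

lemma expectation_sum_square:
  "expectation (\<lambda>x. (\<Sum>j<n. a j * V (t j) x)\<^sup>2) = (\<Sum>i<n. \<Sum>j<n. a i * a j * R (t j - t i))" for n :: nat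
proof -
  have "expectation (\<lambda>x. (\<Sum>j<n. a j * V (t j) x)\<^sup>2) =
      expectation (\<lambda>x. \<Sum>i<n. \<Sum>j<n. (a i * a j) * (V (t i) x * V (t j) x))"
    by (simp add: power2_eq_square sum_product mult_ac)
  also have "\<dots> = (\<Sum>i<n. \<Sum>j<n. expectation (\<lambda>x. (a i * a j) * (V (t i) x * V (t j) x)))"
    by (simp only: Bochner_Integration.integral_sum Bochner_Integration.integrable_sum integrable_mult_right VV_integrable)
  finally show ?thesis by (simp only: integral_mult_right_zero expectation_VV)
qed

lemma gauss_vec_V: "gauss_vec M n (\<lambda>i j. R (t j - t i)) (\<lambda>j. V (t j))"
  unfolding gauss_vec_def
  using centered_gaussian_rv(3)[OF prob_space_axioms gaussian_rv_sum expectation_sum]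
  by (auto simp only: expectation_sum_square intro: prob_space_axioms V_measurable)

lemma gauss_vec_minus_V: "gauss_vec M n (\<lambda>i j. R (t j - t i)) (\<lambda>j x. - V (t j) x)"
  using gauss_vec_coord_scale[OF gauss_vec_V, of n "\<lambda>_. -1" t] by simp

lemma increment_exp:
  "integrable M (\<lambda>x. exp (l * (V t x - V s x)))"
  "expectation (\<lambda>x. exp (l * (V t x - V s x))) = exp (l\<^sup>2 * (R 0 - R (t - s)))"
proof -
  let ?t = "\<lambda>j::nat. if j = 0 then s else t" and ?a = "\<lambda>j::nat. if j = 0 then - 1 else (1::real)"
  have n: "{..<2::nat} = {0, 1}" by auto
  have eq: "(\<Sum>j<2. ?a j * V (?t j) x) = V t x - V s x" for x
    unfolding n by simp
  have sq: "(\<Sum>i<2. \<Sum>j<2. ?a i * ?a j * R (?t j - ?t i)) = 2 * (R 0 - R (t - s))"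
    unfolding n using R_minus[of "t - s"] by simp
  show "integrable M (\<lambda>x. exp (l * (V t x - V s x)))"
    "expectation (\<lambda>x. exp (l * (V t x - V s x))) = exp (l\<^sup>2 * (R 0 - R (t - s)))"
    using centered_gaussian_rv(4,5)[OF prob_space_axioms gaussian_rv_sum[where n = 2 and a = ?a and t = ?t] expectation_sum, of l]
      expectation_sum_square[where n = 2 and a = ?a and t = ?t]
    unfolding sq eq by simp_all
qed

lemma prob_grid_le:
  assumes R: "\<And>t. t \<ge> \<Delta> \<Longrightarrow> R t \<le> \<kappa>" and "\<Delta> > 0" and \<kappa>: "0 \<le> \<kappa>" "\<kappa> < \<sigma>\<^sup>2"
    and "u < u'" "0 \<le> x" "u' + sqrt \<kappa> * x \<le> W * sqrt (\<sigma>\<^sup>2 - \<kappa>)" "0 \<le> W" "h > 0"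
  shows "prob {z \<in> space M. \<forall>j<n. - V (real j * \<Delta>) z \<le> u} \<le>
    exp (- x\<^sup>2 / 2) + exp (- (real n * (h * std_normal_density (W + h))))"
proof (rule gauss_vec_all_le[OF gauss_vec_minus_V, where v = "\<sigma>\<^sup>2" and \<kappa> = \<kappa> and u' = u'])
  fix i j :: nat
  show "R (real j * \<Delta> - real i * \<Delta>) = R (real i * \<Delta> - real j * \<Delta>)"
    using R_minus[of "real j * \<Delta> - real i * \<Delta>"] by simp
  assume "i < j"
  then have "1 * \<Delta> \<le> (real j - real i) * \<Delta>" using \<open>\<Delta> > 0\<close> by (intro mult_right_mono) auto
  then show "R (real j * \<Delta> - real i * \<Delta>) \<le> \<kappa>" by (intro R) (simp add: algebra_simps)
qed (use assms R_0 in auto)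

section \<open>The supremum and its grid approximations\<close>

definition neg_sup :: "real \<Rightarrow> 'a \<Rightarrow> real" where
  "neg_sup T x = (SUP t\<in>{0..T}. - V t x)"

text \<open>Both end points belong to the grid. For \<open>n = 0\<close> division by zero leaves the
  single point 0.\<close>

definition grid_sup :: "nat \<Rightarrow> real \<Rightarrow> 'a \<Rightarrow> real" where
  "grid_sup n T x = Max ((\<lambda>j. - V (real j * T / real n) x) ` {..n})"

lemma path_continuous: "x \<in> space M \<Longrightarrow> continuous_on S (\<lambda>t. V t x)"
  using cont_paths unfolding continuous_sample_paths_def by (auto intro: continuous_on_subset)

lemma neg_sup_attained:
  assumes "x \<in> space M" "T \<ge> 0"
  obtains t where "t \<in> {0..T}" "neg_sup T x = - V t x" "\<And>s. s \<in> {0..T} \<Longrightarrow> V t x \<le> V s x"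
proof -
  obtain t where t: "t \<in> {0..T}" "\<And>s. s \<in> {0..T} \<Longrightarrow> V t x \<le> V s x"
    using continuous_attains_inf[of "{0..T}" "\<lambda>t. V t x"] path_continuous[OF assms(1)] assms(2) by auto
  moreover have "neg_sup T x = - V t x"
    unfolding neg_sup_def by (rule cSup_eq_maximum) (use t in auto)
  ultimately show ?thesis using that by blast
qed

lemma neg_sup_upper: "x \<in> space M \<Longrightarrow> t \<in> {0..T} \<Longrightarrow> - V t x \<le> neg_sup T x"
  using neg_sup_attained[of x T] by (metis atLeastAtMost_iff neg_le_iff_le order_trans)

lemma INF_linear:
  assumes "x \<in> space M" "T \<ge> 0"
  shows "(INF t\<in>{0..T}. sqrt 2 * V t x - c) = - sqrt 2 * neg_sup T x - c"
proof -
  obtain t where "t \<in> {0..T}" "neg_sup T x = - V t x" "\<And>s. s \<in> {0..T} \<Longrightarrow> V t x \<le> V s x"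
    using neg_sup_attained[OF assms] by blast
  then show ?thesis by (intro cInf_eq_minimum) auto
qed

lemma INF_exp:
  assumes "x \<in> space M" "T \<ge> 0"
  shows "(INF t\<in>{0..T}. exp (sqrt 2 * V t x - c)) = exp (- sqrt 2 * neg_sup T x - c)"
proof -
  obtain t where "t \<in> {0..T}" "neg_sup T x = - V t x" "\<And>s. s \<in> {0..T} \<Longrightarrow> V t x \<le> V s x"
    using neg_sup_attained[OF assms] by blast
  then show ?thesis by (intro cInf_eq_minimum) auto
qed

lemma grid_sup_measurable[measurable]: "grid_sup n T \<in> borel_measurable M"
  unfolding grid_sup_def by (intro borel_measurable_Max) auto

lemma grid_sup_le: "x \<in> space M \<Longrightarrow> T \<ge> 0 \<Longrightarrow> grid_sup n T x \<le> neg_sup T x"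
  unfolding grid_sup_def
  by (cases "n = 0") (auto simp: field_simps mult_left_mono intro!: neg_sup_upper)

lemma grid_sup_ge: "j \<le> n \<Longrightarrow> - V (real j * T / real n) x \<le> grid_sup n T x"
  unfolding grid_sup_def by (intro Max_ge) auto

lemma grid_sup_double: "grid_sup n T x \<le> grid_sup (2 * n) T x"
proof -
  have "- V (real j * T / real n) x \<le> grid_sup (2 * n) T x" if "j \<le> n" for j
    using grid_sup_ge[of "2 * j" "2 * n" T x] that by simp
  then show ?thesis unfolding grid_sup_def[of n] by (intro Max.boundedI) auto
qed

lemma incseq_grid_sup: "incseq (\<lambda>k. grid_sup (N * 2 ^ k) T x)"
  by (rule incseq_SucI) (use grid_sup_double[of "N * 2 ^ _" T x] in \<open>simp add: mult_ac\<close>)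

text \<open>By compactness the supremum is attained at some \<open>t\<close>; rounding
  \<open>t\<close> down to the grid gives points converging to it, and continuity of the path
  squeezes the grid maximum.\<close>

lemma grid_sup_tendsto:
  assumes x: "x \<in> space M" and T: "T > 0" and n: "filterlim n at_top sequentially"
  shows "(\<lambda>k. grid_sup (n k) T x) \<longlonglongrightarrow> neg_sup T x"
proof -
  obtain t where t: "t \<in> {0..T}" "neg_sup T x = - V t x"
    using neg_sup_attained[OF x less_imp_le[OF T]] by blast
  define j where "j = (\<lambda>k. nat \<lfloor>t * real (n k) / T\<rfloor>)"
  have ge: "t * real (n k) / T \<ge> 0" for k using t T by auto
  have j: "real (j k) \<le> t * real (n k) / T" "t * real (n k) / T - 1 \<le> real (j k)" for k
  proof -
    have "real (j k) = of_int \<lfloor>t * real (n k) / T\<rfloor>" using ge[of k] by (simp add: j_def)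
    then show "real (j k) \<le> t * real (n k) / T" "t * real (n k) / T - 1 \<le> real (j k)" by linarith+
  qed
  have n0: "eventually (\<lambda>k. n k > 0) sequentially"
    using n eventually_gt_at_top[of "0::nat"] unfolding filterlim_iff by blast
  have "(\<lambda>k. real (j k) * T / real (n k)) \<longlonglongrightarrow> t"
  proof (rule tendsto_sandwich)
    show "\<forall>\<^sub>F k in sequentially. t - T / real (n k) \<le> real (j k) * T / real (n k)"
      using n0
    proof eventually_elim
      case (elim k)
      then have "(t * real (n k) / T - 1) * (T / real (n k)) = t - T / real (n k)" using T by (simp add: field_simps)
      then show ?case using mult_right_mono[OF j(2)[of k], of "T / real (n k)"] T by simp
    qed
    show "\<forall>\<^sub>F k in sequentially. real (j k) * T / real (n k) \<le> t"
      using n0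
    proof eventually_elim
      case (elim k)
      then show ?case using mult_right_mono[OF j(1)[of k], of "T / real (n k)"] T by (simp add: field_simps)
    qed
    have "(\<lambda>k. T / real (n k)) \<longlonglongrightarrow> 0"
      by (intro tendsto_divide_0[OF tendsto_const] filterlim_at_top_imp_at_infinity filterlim_compose[OF filterlim_real_sequentially n])
    then show "(\<lambda>k. t - T / real (n k)) \<longlonglongrightarrow> t" using tendsto_diff[OF tendsto_const] by fastforce
  qed simp
  then have lim: "(\<lambda>k. - V (real (j k) * T / real (n k)) x) \<longlonglongrightarrow> - V t x"
    by (intro tendsto_minus isCont_tendsto_compose[of t "\<lambda>t. V t x"])
      (use path_continuous[OF x, of UNIV] in \<open>auto simp: continuous_on_eq_continuous_at\<close>)
  show ?thesis
    unfolding t(2)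
  proof (rule tendsto_sandwich[OF _ _ lim tendsto_const])
    show "\<forall>\<^sub>F k in sequentially. - V (real (j k) * T / real (n k)) x \<le> grid_sup (n k) T x"
    proof (intro always_eventually allI grid_sup_ge)
      fix k
      have "t * real (n k) / T \<le> real (n k)" using t T by (simp add: field_simps mult_right_mono)
      then show "j k \<le> n k" using j(1)[of k] by linarith
    qed
    show "\<forall>\<^sub>F k in sequentially. grid_sup (n k) T x \<le> - V t x"
      using grid_sup_le[OF x] T unfolding t(2)[symmetric] by (auto intro!: always_eventually)
  qed
qed

lemma grid_sup_tendsto_dyadic:
  assumes "x \<in> space M" "T > 0" "N > 0"
  shows "(\<lambda>k. grid_sup (N * 2 ^ k) T x) \<longlonglongrightarrow> neg_sup T x"
proof (rule grid_sup_tendsto[OF assms(1,2)])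
  have "k \<le> N * 2 ^ k" for k
    using less_exp[of k] assms(3) mult_le_mono1[of 1 N "2 ^ k"] by linarith
  then show "filterlim (\<lambda>k. N * 2 ^ k) at_top sequentially"
    by (intro filterlim_at_top_mono[OF filterlim_ident]) (auto intro: always_eventually)
qed

text \<open>A supremum over uncountably many times becomes measurable as a pointwise limit of grid
  maxima. For negative \<open>T\<close> it is a constant default value.\<close>

lemma neg_sup_measurable[measurable]: "neg_sup T \<in> borel_measurable M"
proof (cases "T > 0")
  case True
  show ?thesis
    by (rule borel_measurable_LIMSEQ_real[OF grid_sup_tendsto_dyadic[of _ T 1]]) (use True in auto)
next
  case False
  then consider "T = 0" | "{0..T} = {}" by force
  then show ?thesis by cases (auto simp: neg_sup_def[abs_def])
qed

lemma G_inf_eq: "T \<ge> 0 \<Longrightarrow> G_inf M V T = expectation (\<lambda>x. exp (- sqrt 2 * neg_sup T x - \<sigma>\<^sup>2))"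
  unfolding G_inf_def variance by (intro Bochner_Integration.integral_cong) (auto simp: INF_exp)

lemma expectation_INF_eq:
  "T \<ge> 0 \<Longrightarrow> expectation (\<lambda>x. INF t\<in>{0..T}. sqrt 2 * V t x - \<sigma>\<^sup>2) = expectation (\<lambda>x. - sqrt 2 * neg_sup T x - \<sigma>\<^sup>2)"
  by (intro Bochner_Integration.integral_cong) (auto simp: INF_linear)

lemma p_inf_eq: "T \<ge> 0 \<Longrightarrow> p_inf M V T C = prob {x \<in> space M. - sqrt 2 * neg_sup T x - \<sigma>\<^sup>2 > C}"
  unfolding p_inf_def variance by (intro arg_cong[of _ _ prob]) (auto simp: INF_linear)

subsection \<open>The ergodic limit\<close>

lemma prob_bounded_below_less_1: "prob {x \<in> space M. - V 0 x \<le> c} \<noteq> 1"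
proof
  assume 1: "prob {x \<in> space M. - V 0 x \<le> c} = 1"
  \<comment> \<open>Chosen so that \<open>l * \<sigma>\<^sup>2 / 2 = \<bar>c\<bar> + 1\<close>,
    whereas an almost sure bound \<open>c\<close> would force this quantity to be at most
    \<open>c\<close>.\<close>
  define l where "l = 2 * (\<bar>c\<bar> + 1) / \<sigma>\<^sup>2"
  have l: "l > 0" using sigma by (simp add: l_def)
  have "AE x in M. x \<in> {x \<in> space M. - V 0 x \<le> c}" by (rule AE_prob_1[OF 1])
  then have "AE x in M. exp ((- l) * V 0 x) \<le> exp (l * c)"
  proof eventually_elim
    case (elim x)
    then have "l * - V 0 x \<le> l * c" using l by (intro mult_left_mono) auto
    then show ?case by simp
  qed
  then have "expectation (\<lambda>x. exp ((- l) * V 0 x)) \<le> expectation (\<lambda>x. exp (l * c))"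
    by (intro integral_mono_AE V_exp) auto
  then have "l\<^sup>2 * \<sigma>\<^sup>2 / 2 \<le> l * c" unfolding V_exp by (simp add: prob_space)
  moreover have "l\<^sup>2 * \<sigma>\<^sup>2 / 2 = l * (\<bar>c\<bar> + 1)"
  proof -
    have "l * \<sigma>\<^sup>2 = 2 * (\<bar>c\<bar> + 1)" using sigma by (simp add: l_def)
    then have "l * (l * \<sigma>\<^sup>2) / 2 = l * (\<bar>c\<bar> + 1)" by simp
    then show ?thesis by (simp only: power2_eq_square mult.assoc)
  qed
  ultimately have "\<bar>c\<bar> + 1 \<le> c" using l by simp
  then show False by simp
qed

text \<open>The events \<open>B s\<close>, that the path stays below \<open>c\<close> from time
  \<open>s\<close> on, increase with \<open>s\<close> and have equal probability by stationarity.
  Hence they agree up to null sets, which is exactly the invariance required by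
  \<open>ergodic_process\<close>.\<close>

lemma AE_unbounded:
  assumes erg: "ergodic_process M V"
  shows "AE x in M. \<exists>t\<ge>0. - V t x > c"
proof -
  \<comment> \<open>Restricting to rational times puts the set into the product sigma-algebra; path
    continuity restores all real times in \<open>B_iff\<close>.\<close>
  define A where "A = {f \<in> space path_space. \<forall>q\<in>\<rat> \<inter> {0..}. - f q \<le> c}"
  have [measurable]: "(\<lambda>f. f q) \<in> borel_measurable path_space" for q
    by (rule measurable_component_singleton) auto
  have A[measurable]: "A \<in> sets path_space"
    unfolding A_def by (intro sets.sets_Collect_countable_All' countable_Int1 countable_rat) measurable
  define B where "B s = {x \<in> space M. path_shift V s x \<in> A}" for s
  have B[measurable]: "B s \<in> events" for s unfolding B_def by measurable
  have B_iff: "x \<in> B s \<longleftrightarrow> (\<forall>t\<ge>s. - V t x \<le> c)" if x: "x \<in> space M" for x s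
  proof
    assume "\<forall>t\<ge>s. - V t x \<le> c"
    then show "x \<in> B s" using x by (auto simp: B_def A_def path_shift_def space_PiM)
  next
    assume xB: "x \<in> B s"
    show "\<forall>t\<ge>s. - V t x \<le> c"
    proof (intro allI impI, rule ccontr)
      fix t assume t: "s \<le> t" "\<not> - V t x \<le> c"
      have "isCont (\<lambda>t. - V t x) t"
        using path_continuous[OF x, of UNIV] by (auto simp: continuous_on_eq_continuous_at)
      then have "((\<lambda>t. - V t x) \<longlongrightarrow> - V t x) (at_right t)"
        by (simp add: isCont_def filterlim_at_split)
      then have "eventually (\<lambda>r. - V r x > c) (at_right t)"
        using t(2) by (intro order_tendstoD) auto
      then obtain b where b: "b > t" "\<And>r. t < r \<Longrightarrow> r < b \<Longrightarrow> - V r x > c"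
        unfolding eventually_at_right_field by auto
      obtain q where q: "q \<in> \<rat>" "t - s < q" "q < b - s"
        using Rats_dense_in_real[of "t - s" "b - s"] b(1) by auto
      then have "- V (q + s) x \<le> c" using xB t(1) by (auto simp: B_def A_def path_shift_def)
      then show False using b(2)[of "q + s"] q by auto
    qed
  qed
  have meas: "measure (distr M path_space (path_shift V s)) A = prob (B s)" for s
    by (subst measure_distr) (auto simp: B_def intro!: arg_cong[of _ _ prob])
  have PB: "prob (B s) = prob (B 0)" for s
    unfolding meas[symmetric] by (rule arg_cong[OF stationary[unfolded stationary_process_def, rule_format]])
  have "AE x in M. path_shift V s x \<in> A \<longleftrightarrow> path_shift V 0 x \<in> A" for s
  proof -
    have sub: "B a \<subseteq> B b" if "a \<le> b" for a b
    proof
      fix x assume "x \<in> B a"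
      moreover then have "x \<in> space M" by (simp add: B_def)
      ultimately show "x \<in> B b" using B_iff that by force
    qed
    have "AE x in M. x \<in> B s \<longleftrightarrow> x \<in> B 0"
    proof (cases "s \<le> 0")
      case True
      then show ?thesis by (intro AE_equal_prob_subset sub PB) auto
    next
      case False
      then have "AE x in M. x \<in> B 0 \<longleftrightarrow> x \<in> B s" by (intro AE_equal_prob_subset sub PB[symmetric]) auto
      then show ?thesis by (auto elim!: AE_mp)
    qed
    then show ?thesis using AE_space by eventually_elim (auto simp: B_def)
  qed
  then have "prob (B 0) \<in> {0, 1}"
    using erg A unfolding ergodic_process_def meas[symmetric] by blast
  moreover have "prob (B 0) \<noteq> 1"
  proof
    assume 1: "prob (B 0) = 1"
    have "prob (B 0) \<le> prob {x \<in> space M. - V 0 x \<le> c}"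
    proof (rule finite_measure_mono)
      show "B 0 \<subseteq> {x \<in> space M. - V 0 x \<le> c}" using B_iff by (auto simp: B_def)
    qed measurable
    then show False using 1 prob_bounded_below_less_1[of c] prob_le_1[of "{x \<in> space M. - V 0 x \<le> c}"] by linarith
  qed
  ultimately have "prob (B 0) = 0" by auto
  then have "AE x in M. x \<notin> B 0" by (intro AE_not_in) (auto simp: emeasure_eq_measure null_sets_def)
  then show ?thesis using AE_space
  proof eventually_elim
    case (elim x)
    then show ?case using B_iff[of x 0] by (auto simp: not_le)
  qed
qed

theorem G_inf_tendsto_0:
  assumes erg: "ergodic_process M V"
  shows "(G_inf M V \<longlongrightarrow> 0) at_top"
proof -
  let ?f = "\<lambda>T x. exp (- sqrt 2 * neg_sup T x - \<sigma>\<^sup>2)"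
  have "((\<lambda>T. expectation (?f T)) \<longlongrightarrow> expectation (\<lambda>x. 0)) at_top"
  proof (rule integral_dominated_convergence_at_top[where w = "\<lambda>x. exp (sqrt 2 * V 0 x)"])
    show "integrable M (\<lambda>x. exp (sqrt 2 * V 0 x))" by (rule V_exp)
    show "\<forall>\<^sub>F T in at_top. AE x in M. norm (?f T x) \<le> exp (sqrt 2 * V 0 x)"
      using eventually_ge_at_top[of 0]
    proof eventually_elim
      case (elim T)
      show ?case
      proof (rule AE_I2)
        fix x assume "x \<in> space M"
        then have "- V 0 x \<le> neg_sup T x" using elim by (intro neg_sup_upper) auto
        then have "sqrt 2 * - V 0 x \<le> sqrt 2 * neg_sup T x" by (intro mult_left_mono) auto
        moreover have "\<sigma>\<^sup>2 \<ge> 0" by simp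
        ultimately have "- sqrt 2 * neg_sup T x - \<sigma>\<^sup>2 \<le> sqrt 2 * V 0 x"
          unfolding mult_minus_right mult_minus_left by linarith
        then show "norm (?f T x) \<le> exp (sqrt 2 * V 0 x)" by simp
      qed
    qed
    have "AE x in M. \<forall>k::nat. \<exists>t\<ge>0. - V t x > real k"
      using AE_unbounded[OF erg] by (simp add: AE_all_countable)
    then show "AE x in M. ((\<lambda>T. ?f T x) \<longlongrightarrow> 0) at_top"
      using AE_space
    proof eventually_elim
      case (elim x)
      have "filterlim (\<lambda>T. neg_sup T x) at_top at_top"
        unfolding filterlim_at_top
      proof
        fix Z
        obtain k :: nat where "Z \<le> real k" using real_arch_simple by blast
        moreover obtain t where "t \<ge> 0" "- V t x > real k" using elim by blast
        ultimately have "Z \<le> neg_sup T x" if "T \<ge> t" for T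
          using neg_sup_upper[OF elim(2), of t T] that by fastforce
        then show "\<forall>\<^sub>F T in at_top. Z \<le> neg_sup T x"
          by (rule eventually_at_top_linorderI)
      qed
      then have "filterlim (\<lambda>T. \<sigma>\<^sup>2 + sqrt 2 * neg_sup T x) at_top at_top"
        by (intro filterlim_tendsto_add_at_top[OF tendsto_const] filterlim_tendsto_pos_mult_at_top[OF tendsto_const]) auto
      then have "((\<lambda>T. exp (- (\<sigma>\<^sup>2 + sqrt 2 * neg_sup T x))) \<longlongrightarrow> 0) at_top"
        by (intro filterlim_compose[OF exp_at_bot] filterlim_compose[OF filterlim_uminus_at_bot_at_top])
      then show ?case by (simp only: minus_add_distrib mult_minus_left diff_conv_add_uminus add.commute)
    qed
  qed auto
  moreover have "\<forall>\<^sub>F T in at_top. expectation (?f T) = G_inf M V T"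
    using eventually_ge_at_top[of 0] by eventually_elim (rule G_inf_eq[symmetric])
  ultimately have "(G_inf M V \<longlongrightarrow> expectation (\<lambda>x. 0)) at_top" by (rule Lim_transform_eventually)
  then show ?thesis by simp
qed

subsection \<open>Lower tail of the supremum\<close>

lemma prob_neg_sup_le:
  assumes "\<And>t. t \<ge> \<Delta> \<Longrightarrow> R t \<le> \<kappa>" and "\<Delta> > 0" and nT: "real n * \<Delta> \<le> T" and "0 \<le> \<kappa>" "\<kappa> < \<sigma>\<^sup>2"
    and "u < u'" "0 \<le> x" "u' + sqrt \<kappa> * x \<le> W * sqrt (\<sigma>\<^sup>2 - \<kappa>)" "0 \<le> W" "h > 0"
  shows "prob {z \<in> space M. neg_sup T z \<le> u} \<le>
    exp (- x\<^sup>2 / 2) + exp (- (real n * (h * std_normal_density (W + h))))"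
proof -
  have "prob {z \<in> space M. neg_sup T z \<le> u} \<le> prob {z \<in> space M. \<forall>j<n. - V (real j * \<Delta>) z \<le> u}"
  proof (rule finite_measure_mono)
    show "{z \<in> space M. neg_sup T z \<le> u} \<subseteq> {z \<in> space M. \<forall>j<n. - V (real j * \<Delta>) z \<le> u}"
    proof safe
      fix z j assume z: "z \<in> space M" "neg_sup T z \<le> u" and "j < n"
      then have "real j * \<Delta> \<le> real n * \<Delta>" using \<open>\<Delta> > 0\<close> by (intro mult_right_mono) auto
      also note nT
      finally have "real j * \<Delta> \<in> {0..T}" using \<open>\<Delta> > 0\<close> by simp
      from order_trans[OF neg_sup_upper[OF z(1) this] z(2)] show "- V (real j * \<Delta>) z \<le> u" .
    qed
  qed measurable
  also have "\<dots> \<le> exp (- x\<^sup>2 / 2) + exp (- (real n * (h * std_normal_density (W + h))))"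
    using assms by (intro prob_grid_le)
  finally show ?thesis .
qed

text \<open>A bound uniform over all lags beyond the spacing, as the grid comparison requires. It is
  one-sided because Slepian's inequality asks for upper bounds on covariances.\<close>

lemma berman_eventually_le:
  assumes "berman_condition R" "\<eta> > 0"
  shows "\<forall>\<^sub>F \<Delta> in at_top. \<forall>t\<ge>\<Delta>. R t \<le> \<eta> / ln \<Delta>"
proof -
  have "\<forall>\<^sub>F t in at_top. ln t * R t < \<eta>"
    using assms unfolding berman_condition_def by (intro order_tendstoD) auto
  then obtain N where N: "\<And>t. t \<ge> N \<Longrightarrow> ln t * R t < \<eta>" unfolding eventually_at_top_linorder by blast
  show ?thesis
    using eventually_gt_at_top[of 1] eventually_ge_at_top[of N]
  proof eventually_elim
    case (elim \<Delta>)
    show ?case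
    proof (intro allI impI)
      fix t assume t: "\<Delta> \<le> t"
      have l: "0 < ln \<Delta>" "ln \<Delta> \<le> ln t" using elim t by auto
      have "R t \<le> \<eta> / ln t" using N[of t] elim t l by (simp add: pos_le_divide_eq mult.commute)
      also have "\<dots> \<le> \<eta> / ln \<Delta>" using l assms(2) by (intro divide_left_mono) auto
      finally show "R t \<le> \<eta> / ln \<Delta>" .
    qed
  qed
qed

theorem p_inf_smallo:
  assumes berman: "berman_condition R" and m: "m > 0"
  shows "(\<lambda>T. p_inf M V T C) \<in> o[at_top](\<lambda>T. T powr (- m))"
proof -
  \<comment> \<open>A fixed threshold suffices: \<open>sqrt \<kappa> * x\<close> below equals
    \<open>sqrt (4 * (m + 1))\<close> for every \<open>T\<close>, and
    \<open>\<sigma>\<^sup>2 - \<kappa>\<close> is eventually at least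
    \<open>\<sigma>\<^sup>2 / 2\<close>.\<close>
  define W where "W = (\<bar>C\<bar> + 1 + sqrt (4 * (m + 1))) / sqrt (\<sigma>\<^sup>2 / 2)"
  define q where "q = std_normal_density (W + 1)"
  have W: "W \<ge> 0" using m sigma by (simp add: W_def)
  have q: "q > 0" unfolding q_def by (rule normal_density_pos) simp
  have "\<forall>\<^sub>F T in at_top. \<forall>t\<ge>sqrt T. R t \<le> 1 / ln (sqrt T)"
    using berman_eventually_le[OF berman, of 1] by (intro eventually_compose_filterlim[OF _ sqrt_at_top]) auto
  moreover have "\<forall>\<^sub>F T in at_top. 2 / ln T \<le> \<sigma>\<^sup>2 / 2"
  proof -
    have "((\<lambda>T::real. 2 / ln T) \<longlongrightarrow> 0) at_top" by real_asymp
    then show ?thesis using sigma by (intro eventually_mono[OF order_tendstoD(2)[of _ 0 _ "\<sigma>\<^sup>2 / 2"]]) auto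
  qed
  ultimately have bound: "\<forall>\<^sub>F T in at_top. p_inf M V T C \<le> T powr (- (m + 1)) + exp (- ((sqrt T - 1) * q))"
    using eventually_gt_at_top[of 1]
  proof eventually_elim
    case (elim T)
    \<comment> \<open>The cut \<open>?x\<close> makes the exceptional probability
      \<open>T powr (- (m + 1))\<close>, one power better than required, which turns the bound into
      a small-o statement. About \<open>sqrt T\<close> independent parts below a fixed threshold
      leave a much smaller term.\<close>
    let ?\<kappa> = "2 / ln T" and ?n = "nat \<lfloor>sqrt T\<rfloor>" and ?x = "sqrt (2 * (m + 1) * ln T)"
    have lT: "ln T > 0" "T > 1" using elim by auto
    have n: "real ?n \<le> sqrt T" "sqrt T - 1 \<le> real ?n"
    proof -
      have "real ?n = of_int \<lfloor>sqrt T\<rfloor>" using lT by simp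
      then show "real ?n \<le> sqrt T" "sqrt T - 1 \<le> real ?n" by linarith+
    qed
    have "p_inf M V T C \<le> prob {z \<in> space M. neg_sup T z \<le> \<bar>C\<bar>}"
    proof -
      have "neg_sup T z \<le> \<bar>C\<bar>" if "- sqrt 2 * neg_sup T z - \<sigma>\<^sup>2 > C" for z
      proof (rule ccontr)
        assume "\<not> ?thesis"
        then have "\<bar>C\<bar> \<le> neg_sup T z" by simp
        then have "1 * \<bar>C\<bar> \<le> sqrt 2 * neg_sup T z" by (intro mult_mono) auto
        then show False using that zero_le_power2[of \<sigma>] abs_ge_minus_self[of C] unfolding mult_minus_left by linarith
      qed
      then show ?thesis using lT by (subst p_inf_eq) (auto intro!: finite_measure_mono)
    qed
    also have "\<dots> \<le> exp (- ?x\<^sup>2 / 2) + exp (- (real ?n * (1 * std_normal_density (W + 1))))"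
    proof (rule prob_neg_sup_le[where \<Delta> = "sqrt T" and \<kappa> = ?\<kappa> and u' = "\<bar>C\<bar> + 1"])
      show "R t \<le> ?\<kappa>" if "t \<ge> sqrt T" for t using elim that lT by (simp add: ln_sqrt)
      show "real ?n * sqrt T \<le> T" using mult_right_mono[OF n(1), of "sqrt T"] lT by simp
      show "?\<kappa> < \<sigma>\<^sup>2" using elim sigma by (smt (verit) field_sum_of_halves zero_less_power)
      have "sqrt ?\<kappa> * ?x = sqrt (4 * (m + 1))" using lT by (simp flip: real_sqrt_mult)
      then have "\<bar>C\<bar> + 1 + sqrt ?\<kappa> * ?x = W * sqrt (\<sigma>\<^sup>2 / 2)" using sigma by (simp add: W_def)
      also have "\<dots> \<le> W * sqrt (\<sigma>\<^sup>2 - ?\<kappa>)" using W elim by (intro mult_left_mono real_sqrt_le_mono) auto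
      finally show "\<bar>C\<bar> + 1 + sqrt ?\<kappa> * ?x \<le> W * sqrt (\<sigma>\<^sup>2 - ?\<kappa>)" .
    qed (use lT W m in auto)
    also have "exp (- ?x\<^sup>2 / 2) = T powr (- (m + 1))"
    proof -
      have "?x\<^sup>2 = 2 * ((m + 1) * ln T)" using lT m by simp
      then have "- ?x\<^sup>2 / 2 = - (m + 1) * ln T" by (simp only: minus_mult_left)
      then show ?thesis using lT by (simp only: powr_def) simp
    qed
    also have "exp (- (real ?n * (1 * std_normal_density (W + 1)))) \<le> exp (- ((sqrt T - 1) * q))"
      using n(2) q by (simp add: q_def[symmetric] mult_right_mono)
    finally show ?case by simp
  qed
  have "(\<lambda>T. p_inf M V T C) \<in> O[at_top](\<lambda>T. T powr (- (m + 1)) + exp (- ((sqrt T - 1) * q)))"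
    using bound by (intro bigoI[where c = 1]) (auto elim!: eventually_mono simp: p_inf_def)
  moreover have "(\<lambda>T. T powr (- (m + 1)) + exp (- ((sqrt T - 1) * q))) \<in> o[at_top](\<lambda>T. T powr (- m))"
    using m q by real_asymp
  ultimately show ?thesis by (rule landau_o.big_small_trans)
qed

lemma sqrt_ln_at_top: "filterlim (\<lambda>T::real. sqrt (ln T)) at_top at_top"
  by (rule filterlim_compose[OF sqrt_at_top ln_at_top])

text \<open>
  With \<open>L = sqrt (ln T)\<close> take spacing \<open>exp (\<delta> L)\<close>, hence \<open>\<kappa> = \<eta> / (\<delta> L)\<close>, and cut the common part at
  \<open>x = sqrt (K L)\<close>. The shift \<open>sqrt \<kappa> x\<close> is then a constant that is small with \<open>\<eta>\<close>, while the
  \<open>T exp (- \<delta> L)\<close> independent parts still exceed the lowered level.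
\<close>

lemma prob_neg_sup_lower_tail:
  assumes berman: "berman_condition R" and \<epsilon>: "\<epsilon> > 0" and K: "K > 0"
  shows "\<forall>\<^sub>F T in at_top. prob {z \<in> space M. neg_sup T z \<le> sqrt 2 * \<sigma> * sqrt (ln T) - \<epsilon>}
    \<le> 2 * exp (- K * sqrt (ln T) / 2)"
proof -
  \<comment> \<open>The gap \<open>\<epsilon> / 2\<close> between \<open>u'\<close> and the full
    level is spent as follows: \<open>2 * \<delta> * \<sigma> = \<epsilon> / 4\<close> for lowering
    the threshold \<open>?W\<close>, \<open>\<epsilon> / 8\<close> for the common part, and
    \<open>\<epsilon> / 8\<close> for replacing \<open>sqrt (\<sigma>\<^sup>2 - \<kappa>)\<close> by
    \<open>\<sigma>\<close>. The two entries in the minimum defining \<open>\<eta>\<close> secure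
    the last two.\<close>
  define \<delta> where "\<delta> = \<epsilon> / (8 * \<sigma>)"
  have \<delta>: "\<delta> > 0" using \<epsilon> sigma by (simp add: \<delta>_def)
  define \<eta> where "\<eta> = min (\<delta> * \<epsilon>\<^sup>2 / (64 * K)) (\<delta> * \<sigma> * \<epsilon> / 16)"
  have \<eta>: "\<eta> > 0" "\<eta> * K / \<delta> \<le> (\<epsilon> / 8)\<^sup>2" "sqrt 2 * \<eta> / (\<delta> * \<sigma>) \<le> \<epsilon> / 8"
  proof -
    show "\<eta> > 0" using \<delta> \<epsilon> K sigma by (simp add: \<eta>_def)
    have "\<eta> \<le> \<delta> * \<epsilon>\<^sup>2 / (64 * K)" by (simp add: \<eta>_def)
    then show "\<eta> * K / \<delta> \<le> (\<epsilon> / 8)\<^sup>2" using K \<delta> by (simp add: field_simps power2_eq_square)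
    have "sqrt 2 * \<eta> \<le> 2 * \<eta>" using \<open>\<eta> > 0\<close> sqrt_le_D by (intro mult_right_mono real_le_lsqrt) auto
    also have "\<dots> \<le> \<delta> * \<sigma> * \<epsilon> / 8" by (simp add: \<eta>_def)
    finally show "sqrt 2 * \<eta> / (\<delta> * \<sigma>) \<le> \<epsilon> / 8" using \<delta> sigma by (simp add: field_simps)
  qed
  \<comment> \<open>Thinning divides the number of points by \<open>exp (\<delta> * L)\<close>,
    while evaluating the density at \<open>sqrt 2 * L - \<delta>\<close> gains
    \<open>exp (sqrt 2 * \<delta> * L)\<close>. As \<open>sqrt 2 > 1\<close>, the exponent in the
    bound still grows like \<open>exp (a * L)\<close>.\<close>
  define a where "a = (sqrt 2 - 1) * \<delta>"
  have a: "a > 0" using \<delta> by (simp add: a_def)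
  define C where "C = \<delta> / sqrt (2 * pi) * exp (- \<delta>\<^sup>2 / 2)"
  have C: "C > 0" using \<delta> by (simp add: C_def)
  have "filterlim (\<lambda>T. exp (\<delta> * sqrt (ln T))) at_top at_top"
    by (intro filterlim_compose[OF exp_at_top] filterlim_tendsto_pos_mult_at_top[OF tendsto_const \<delta>] sqrt_ln_at_top)
  then have e1: "\<forall>\<^sub>F T in at_top. \<forall>t\<ge>exp (\<delta> * sqrt (ln T)). R t \<le> \<eta> / ln (exp (\<delta> * sqrt (ln T)))"
    using berman_eventually_le[OF berman \<eta>(1)] by (rule eventually_compose_filterlim[rotated])
  have "\<forall>\<^sub>F L in at_top. \<eta> / (\<delta> * L) < \<sigma>\<^sup>2"
    using \<eta>(1) \<delta> sigma by real_asymp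
  then have e2: "\<forall>\<^sub>F T in at_top. \<eta> / (\<delta> * sqrt (ln T)) < \<sigma>\<^sup>2"
    using sqrt_ln_at_top by (rule eventually_compose_filterlim)
  have "\<forall>\<^sub>F L in at_top. K * L / 2 \<le> C * (exp (a * L) - exp (sqrt 2 * \<delta> * L - L\<^sup>2))"
    using a C K \<delta> by real_asymp
  then have e3: "\<forall>\<^sub>F T in at_top. K * sqrt (ln T) / 2 \<le> C * (exp (a * sqrt (ln T)) - exp (sqrt 2 * \<delta> * sqrt (ln T) - (sqrt (ln T))\<^sup>2))"
    using sqrt_ln_at_top by (rule eventually_compose_filterlim)
  have "\<forall>\<^sub>F L in at_top. 0 \<le> sqrt 2 * L - 2 * \<delta>" by real_asymp
  then have e4: "\<forall>\<^sub>F T in at_top. 0 \<le> sqrt 2 * sqrt (ln T) - 2 * \<delta>"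
    using sqrt_ln_at_top by (rule eventually_compose_filterlim)
  show ?thesis
    using e1 e2 e3 e4 eventually_gt_at_top[of 1]
  proof eventually_elim
    case (elim T)
    define L where "L = sqrt (ln T)"
    note elim = elim[folded L_def]
    have L: "L > 0" "exp (L\<^sup>2) = T" using elim by (simp_all add: L_def)
    let ?\<Delta> = "exp (\<delta> * L)" and ?\<kappa> = "\<eta> / (\<delta> * L)" and ?n = "nat \<lfloor>T / exp (\<delta> * L)\<rfloor>" and ?x = "sqrt (K * L)"
    let ?W = "sqrt 2 * L - 2 * \<delta>"
    have n: "real ?n \<le> T / ?\<Delta>" "T / ?\<Delta> - 1 \<le> real ?n"
    proof -
      have "T / ?\<Delta> \<ge> 0" using elim by simp
      then have "real ?n = of_int \<lfloor>T / ?\<Delta>\<rfloor>" by simp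
      then show "real ?n \<le> T / ?\<Delta>" "T / ?\<Delta> - 1 \<le> real ?n" by linarith+
    qed
    have \<kappa>0: "?\<kappa> \<ge> 0" using \<eta> \<delta> L by simp
    have "prob {z \<in> space M. neg_sup T z \<le> sqrt 2 * \<sigma> * L - \<epsilon>} \<le>
        exp (- ?x\<^sup>2 / 2) + exp (- (real ?n * (\<delta> * std_normal_density (?W + \<delta>))))"
    proof (rule prob_neg_sup_le[where \<Delta> = ?\<Delta> and \<kappa> = ?\<kappa> and u' = "sqrt 2 * \<sigma> * L - \<epsilon> / 2"])
      show "R t \<le> ?\<kappa>" if "t \<ge> ?\<Delta>" for t using elim that by simp
      show "real ?n * ?\<Delta> \<le> T" using mult_right_mono[OF n(1), of ?\<Delta>] by simp
      have "sqrt ?\<kappa> * ?x = sqrt (\<eta> * K / \<delta>)" using L by (simp flip: real_sqrt_mult)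
      also have "\<dots> \<le> \<epsilon> / 8" using \<eta>(2) \<epsilon> by (intro real_le_lsqrt) auto
      finally have 1: "sqrt ?\<kappa> * ?x \<le> \<epsilon> / 8" .
      have square: "(s - k / s)\<^sup>2 = s\<^sup>2 - 2 * k + k * (k / s\<^sup>2)" if "s > 0" for s k :: real
        using that by (simp add: power2_eq_square field_simps)
      have lin: "b \<le> s - 2 * k + k * 1 \<Longrightarrow> b \<le> s - k" for b s k :: real by simp
      have "\<sigma> - ?\<kappa> / \<sigma> \<le> sqrt (\<sigma>\<^sup>2 - ?\<kappa>)"
      proof (rule real_le_rsqrt)
        have "(\<sigma> - ?\<kappa> / \<sigma>)\<^sup>2 = \<sigma>\<^sup>2 - 2 * ?\<kappa> + ?\<kappa> * (?\<kappa> / \<sigma>\<^sup>2)"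
          using square[OF sigma] .
        also have "\<dots> \<le> \<sigma>\<^sup>2 - 2 * ?\<kappa> + ?\<kappa> * 1"
        proof (intro add_left_mono mult_left_mono \<kappa>0)
          show "?\<kappa> / \<sigma>\<^sup>2 \<le> 1" using divide_right_mono[OF less_imp_le[OF elim(2)], of "\<sigma>\<^sup>2"] sigma by simp
        qed
        finally show "(\<sigma> - ?\<kappa> / \<sigma>)\<^sup>2 \<le> \<sigma>\<^sup>2 - ?\<kappa>" by (rule lin)
      qed
      then have "?W * (\<sigma> - ?\<kappa> / \<sigma>) \<le> ?W * sqrt (\<sigma>\<^sup>2 - ?\<kappa>)" using elim by (intro mult_left_mono) auto
      moreover have "?W * (\<sigma> - ?\<kappa> / \<sigma>) = sqrt 2 * \<sigma> * L - \<epsilon> / 4 - sqrt 2 * \<eta> / (\<delta> * \<sigma>) + 2 * \<delta> * (?\<kappa> / \<sigma>)"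
      proof -
        have "2 * \<delta> * \<sigma> = \<epsilon> / 4" using sigma by (simp add: \<delta>_def)
        moreover have "sqrt 2 * L * (?\<kappa> / \<sigma>) = sqrt 2 * \<eta> / (\<delta> * \<sigma>)" using L by simp
        moreover have "?W * (\<sigma> - ?\<kappa> / \<sigma>) = sqrt 2 * \<sigma> * L - 2 * \<delta> * \<sigma> - sqrt 2 * L * (?\<kappa> / \<sigma>) + 2 * \<delta> * (?\<kappa> / \<sigma>)"
          by (simp only: left_diff_distrib right_diff_distrib) (simp add: mult_ac)
        ultimately show ?thesis by simp
      qed
      moreover have "2 * \<delta> * (?\<kappa> / \<sigma>) \<ge> 0"
        using \<delta> sigma by (intro mult_nonneg_nonneg divide_nonneg_nonneg[OF \<kappa>0]) auto
      ultimately show "sqrt 2 * \<sigma> * L - \<epsilon> / 2 + sqrt ?\<kappa> * ?x \<le> ?W * sqrt (\<sigma>\<^sup>2 - ?\<kappa>)"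
        using 1 \<eta>(3) by linarith
    qed (use elim L K \<delta> \<epsilon> \<kappa>0 in auto)
    also have "exp (- ?x\<^sup>2 / 2) = exp (- K * L / 2)" using K L by simp
    also have "exp (- (real ?n * (\<delta> * std_normal_density (?W + \<delta>)))) \<le> exp (- K * L / 2)"
    proof -
      have 1: "\<delta> * std_normal_density (?W + \<delta>) = C * exp (sqrt 2 * \<delta> * L - L\<^sup>2)"
      proof -
        have "- (?W + \<delta>)\<^sup>2 / 2 = - \<delta>\<^sup>2 / 2 + (sqrt 2 * \<delta> * L - L\<^sup>2)"
          by (simp add: power2_diff power_mult_distrib algebra_simps add_divide_distrib diff_divide_distrib)
        then show ?thesis by (simp only: std_normal_density_def C_def exp_add) (simp add: mult_ac)
      qed
      have 2: "(T / ?\<Delta> - 1) * (C * exp (sqrt 2 * \<delta> * L - L\<^sup>2)) = C * (exp (a * L) - exp (sqrt 2 * \<delta> * L - L\<^sup>2))"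
      proof -
        have "T / ?\<Delta> = exp (L\<^sup>2 - \<delta> * L)" using L(2) by (simp add: exp_diff)
        then have "T / ?\<Delta> * exp (sqrt 2 * \<delta> * L - L\<^sup>2) = exp (a * L)"
          by (simp add: exp_add[symmetric] a_def algebra_simps)
        then show ?thesis by (simp add: algebra_simps)
      qed
      have 3: "(T / ?\<Delta> - 1) * (C * exp (sqrt 2 * \<delta> * L - L\<^sup>2)) \<le> real ?n * (C * exp (sqrt 2 * \<delta> * L - L\<^sup>2))"
        using n(2) C by (intro mult_right_mono) auto
      have "K * L / 2 \<le> (T / ?\<Delta> - 1) * (C * exp (sqrt 2 * \<delta> * L - L\<^sup>2))" unfolding 2 by (rule elim(3))
      from order_trans[OF this 3] have "K * L / 2 \<le> real ?n * (\<delta> * std_normal_density (?W + \<delta>))" unfolding 1 .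
      then show ?thesis
        by (simp only: exp_le_cancel_iff neg_le_iff_le minus_mult_left[symmetric] minus_divide_left[symmetric])
    qed
    finally show ?case unfolding L_def by simp
  qed
qed

text \<open>Off the rare event \<open>A\<close> the integrand is at most
  \<open>exp (sqrt 2 * \<epsilon>)\<close>. On \<open>A\<close> the value at time 0 gives a crude
  bound, and the product of its exponential with the indicator is split as in the Cauchy-Schwarz
  inequality, done pointwise by 2e \<le> \<theta> e^2 + 1/\<theta>.\<close>

lemma expectation_exp_upper:
  assumes berman: "berman_condition R" and \<epsilon>: "\<epsilon> > 0"
  shows "\<forall>\<^sub>F T in at_top. expectation (\<lambda>x. exp (2 * \<sigma> * sqrt (ln T) - sqrt 2 * neg_sup T x)) \<le> exp (sqrt 2 * \<epsilon>) + \<epsilon>"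
proof -
  define B where "B = exp (4 * \<sigma>\<^sup>2)"
  define K where "K = 8 * \<sigma> + 4"
  have K: "K > 0" using sigma by (simp add: K_def)
  have "\<forall>\<^sub>F L in at_top. (B + 2) / 2 * exp (- L) \<le> \<epsilon>" using \<epsilon> by real_asymp
  then have e1: "\<forall>\<^sub>F T in at_top. (B + 2) / 2 * exp (- sqrt (ln T)) \<le> \<epsilon>"
    using sqrt_ln_at_top by (rule eventually_compose_filterlim)
  show ?thesis
    using e1 prob_neg_sup_lower_tail[OF berman \<epsilon> K] eventually_gt_at_top[of 1]
  proof eventually_elim
    case (elim T)
    define L where "L = sqrt (ln T)"
    note elim = elim[folded L_def]
    define A where "A = {z \<in> space M. neg_sup T z \<le> sqrt 2 * \<sigma> * L - \<epsilon>}"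
    have A[measurable]: "A \<in> events" unfolding A_def by measurable
    \<comment> \<open>With this \<open>\<theta>\<close> the moment term decays like
      \<open>exp (- L)\<close> after multiplication by \<open>exp (2 * \<sigma> * L)\<close>;
      \<open>K = 8 * \<sigma> + 4\<close> is the value for which the probability term decays at the
      same rate.\<close>
    define \<theta> where "\<theta> = exp (- (2 * \<sigma> + 1) * L)"
    have \<theta>: "\<theta> > 0" by (simp add: \<theta>_def)
    let ?g = "\<lambda>x. exp (sqrt 2 * \<epsilon>) + exp (2 * \<sigma> * L) / 2 * (\<theta> * exp (2 * sqrt 2 * V 0 x) + indicator A x / \<theta>)"
    have gi: "integrable M ?g"
      by (intro Bochner_Integration.integrable_add integrable_mult_right integrable_divide V_exp integrable_const
          integrable_real_indicator) (auto simp: emeasure_eq_measure)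
    have "expectation (\<lambda>x. exp (2 * \<sigma> * L - sqrt 2 * neg_sup T x)) \<le> expectation ?g"
    proof (rule integral_mono')
      show "integrable M ?g" by (rule gi)
      fix x assume x: "x \<in> space M"
      show "0 \<le> ?g x" using \<theta> by simp
      show "exp (2 * \<sigma> * L - sqrt 2 * neg_sup T x) \<le> ?g x"
      proof (cases "x \<in> A")
        case False
        then have "sqrt 2 * (sqrt 2 * \<sigma> * L - \<epsilon>) \<le> sqrt 2 * neg_sup T x"
          using x by (intro mult_left_mono) (auto simp: A_def)
        then have "2 * \<sigma> * L - sqrt 2 * neg_sup T x \<le> sqrt 2 * \<epsilon>" by (simp add: algebra_simps)
        then have "exp (2 * \<sigma> * L - sqrt 2 * neg_sup T x) \<le> exp (sqrt 2 * \<epsilon>)" by simp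
        also have "\<dots> \<le> ?g x" using \<theta> by simp
        finally show ?thesis .
      next
        case True
        have "- V 0 x \<le> neg_sup T x" using x elim by (intro neg_sup_upper) auto
        then have "sqrt 2 * - V 0 x \<le> sqrt 2 * neg_sup T x" by (intro mult_left_mono) auto
        then have "exp (2 * \<sigma> * L - sqrt 2 * neg_sup T x) \<le> exp (2 * \<sigma> * L) * exp (sqrt 2 * V 0 x)"
          by (simp flip: exp_add)
        also have "exp (sqrt 2 * V 0 x) \<le> (\<theta> * exp (2 * sqrt 2 * V 0 x) + 1 / \<theta>) / 2"
        proof -
          let ?e = "exp (sqrt 2 * V 0 x)"
          have "0 \<le> (\<theta> * ?e - 1)\<^sup>2 / \<theta>" using \<theta> by simp
          also have "\<dots> = \<theta> * ?e\<^sup>2 + 1 / \<theta> - 2 * ?e" using \<theta> by (simp add: power2_eq_square field_simps)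
          also have "?e\<^sup>2 = exp (2 * sqrt 2 * V 0 x)" by (simp add: power2_eq_square flip: exp_add)
          finally show ?thesis by simp
        qed
        also have "exp (2 * \<sigma> * L) * ((\<theta> * exp (2 * sqrt 2 * V 0 x) + 1 / \<theta>) / 2) \<le> ?g x"
          using True by simp
        finally show ?thesis by simp
      qed
    qed
    also have "\<dots> = exp (sqrt 2 * \<epsilon>) + exp (2 * \<sigma> * L) / 2 * (\<theta> * B + prob A / \<theta>)"
    proof -
      have "expectation (\<lambda>x. exp (2 * sqrt 2 * V 0 x)) = B"
        unfolding V_exp B_def by (simp add: power_mult_distrib)
      moreover have "integrable M (\<lambda>x. \<theta> * exp (2 * sqrt 2 * V 0 x))" "integrable M (\<lambda>x. indicator A x / \<theta> :: real)"
        by (intro integrable_mult_right integrable_divide V_exp integrable_real_indicator; auto simp: emeasure_eq_measure)+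
      ultimately show ?thesis
        by (simp add: prob_space)
    qed
    also have "\<dots> \<le> exp (sqrt 2 * \<epsilon>) + exp (2 * \<sigma> * L) / 2 * (\<theta> * B + 2 * exp (- K * L / 2) / \<theta>)"
      using elim(2) \<theta> unfolding A_def by (intro add_left_mono mult_left_mono divide_right_mono) auto
    also have "exp (2 * \<sigma> * L) / 2 * (\<theta> * B + 2 * exp (- K * L / 2) / \<theta>) = (B + 2) / 2 * exp (- L)"
    proof -
      have "exp (2 * \<sigma> * L) * \<theta> = exp (- L)" unfolding \<theta>_def by (simp add: algebra_simps flip: exp_add)
      moreover have "exp (2 * \<sigma> * L) * exp (- K * L / 2) / \<theta> = exp (- L)"
      proof -
        have "- K * L / 2 = - (4 * \<sigma> + 2) * L" by (simp add: K_def field_simps)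
        then show ?thesis unfolding \<theta>_def by (simp add: algebra_simps flip: exp_add exp_diff)
      qed
      ultimately show ?thesis by (simp add: algebra_simps add_divide_distrib)
    qed
    finally show ?case using elim(1) unfolding L_def by simp
  qed
qed

subsection \<open>Chaining\<close>

text \<open>The factor \<open>s\<close> encodes the absolute value of an increment as a maximum of two centered Gaussians.\<close>

definition grid_inc :: "nat \<Rightarrow> real \<Rightarrow> 'a \<Rightarrow> real" where
  "grid_inc n T x = (MAX (j, s)\<in>{..<n} \<times> {- 1, 1}. s * (V (real (Suc j) * T / real n) x - V (real j * T / real n) x))"

lemma grid_inc_ge:
  assumes "j < n"
  shows "V (real j * T / real n) x - V (real (Suc j) * T / real n) x \<le> grid_inc n T x" "0 \<le> grid_inc n T x"
proof -
  let ?d = "V (real (Suc j) * T / real n) x - V (real j * T / real n) x"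
  have "(case (j, s) of (j, s) \<Rightarrow> s * (V (real (Suc j) * T / real n) x - V (real j * T / real n) x)) \<le> grid_inc n T x"
    if "s \<in> {- 1, 1}" for s
    unfolding grid_inc_def using assms that by (intro Max_ge) auto
  from this[of "- 1"] this[of 1] show "V (real j * T / real n) x - V (real (Suc j) * T / real n) x \<le> grid_inc n T x" "0 \<le> grid_inc n T x"
    by auto
qed

text \<open>An even point of the finer grid lies on the coarser one; an odd point is one fine step
  from its even left neighbour.\<close>

lemma grid_sup_refine:
  assumes "n > 0"
  shows "grid_sup (2 * n) T x \<le> grid_sup n T x + grid_inc (2 * n) T x"
proof -
  have "- V (real i * T / real (2 * n)) x \<le> grid_sup n T x + grid_inc (2 * n) T x" if "i \<le> 2 * n" for i
  proof (cases "even i")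
    case True
    then obtain j where "i = 2 * j" by blast
    then show ?thesis using that grid_sup_ge[of j n T x] grid_inc_ge(2)[of 0 "2 * n" T x] assms by simp
  next
    case False
    then obtain j where i: "i = Suc (2 * j)" using oddE by fastforce
    have "- V (real (2 * j) * T / real (2 * n)) x \<le> grid_sup n T x"
      using that grid_sup_ge[of j n T x] i by simp
    moreover have "V (real (2 * j) * T / real (2 * n)) x - V (real i * T / real (2 * n)) x \<le> grid_inc (2 * n) T x"
      using that unfolding i by (intro grid_inc_ge) auto
    ultimately show ?thesis by linarith
  qed
  then show ?thesis unfolding grid_sup_def[of "2 * n"] by (intro Max.boundedI) auto
qed

lemma grid_sup_integrable: "integrable M (grid_sup n T)"
  unfolding grid_sup_def[abs_def] by (intro integrable_MAX) (auto intro!: V_integrable)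

lemma expectation_grid_sup_le:
  assumes "l > 0"
  shows "expectation (grid_sup n T) \<le> (ln (real (Suc n)) + l\<^sup>2 * \<sigma>\<^sup>2 / 2) / l"
proof -
  have "expectation (\<lambda>x. MAX j\<in>{..n}. - V (real j * T / real n) x) \<le> ln (real (card {..n}) * exp (l\<^sup>2 * \<sigma>\<^sup>2 / 2)) / l"
  proof (rule expectation_MAX_le)
    show "integrable M (\<lambda>x. exp (l * - V (real j * T / real n) x))"
      "expectation (\<lambda>x. exp (l * - V (real j * T / real n) x)) \<le> exp (l\<^sup>2 * \<sigma>\<^sup>2 / 2)" for j
      using V_exp[of "- l"] by simp_all
  qed (use assms in \<open>auto intro!: V_integrable\<close>)
  then show ?thesis unfolding grid_sup_def[abs_def] by (simp add: ln_mult)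
qed

lemma grid_inc_integrable: "n > 0 \<Longrightarrow> integrable M (grid_inc n T)"
  unfolding grid_inc_def[abs_def] by (intro integrable_MAX) (auto intro!: V_integrable)

text \<open>The parameter \<open>1 / b\<close> bounds each exponential moment by
  \<open>exp 1\<close>. This yields a logarithm instead of its square root, which the geometric
  decay in the chaining absorbs.\<close>

lemma expectation_grid_inc_le:
  assumes n: "n > 0" and b: "b > 0" "R 0 - R (T / real n) \<le> b\<^sup>2"
  shows "expectation (grid_inc n T) \<le> b * (ln (real (2 * n)) + 1)"
proof -
  let ?I = "{..<n} \<times> {- 1, 1 :: real}"
  let ?Y = "\<lambda>(j, s) x. s * (V (real (Suc j) * T / real n) x - V (real j * T / real n) x)"
  have "expectation (\<lambda>x. MAX i\<in>?I. ?Y i x) \<le> ln (real (card ?I) * exp 1) / (1 / b)"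
  proof (rule expectation_MAX_le)
    fix i assume i: "i \<in> ?I"
    obtain j s where js: "i = (j, s)" by (cases i) auto
    have s: "s\<^sup>2 = 1" using i js by auto
    have d: "real (Suc j) * T / real n - real j * T / real n = T / real n"
      by (simp add: distrib_right add_divide_distrib)
    have eq: "exp (1 / b * ?Y i x) = exp ((s / b) * (V (real (Suc j) * T / real n) x - V (real j * T / real n) x))" for x
      by (simp add: js)
    show "integrable M (\<lambda>x. exp (1 / b * ?Y i x))" unfolding eq by (rule increment_exp)
    have "(R 0 - R (T / real n)) / b\<^sup>2 \<le> 1" using b by (simp add: pos_divide_le_eq)
    then show "expectation (\<lambda>x. exp (1 / b * ?Y i x)) \<le> exp 1"
      unfolding eq increment_exp d by (simp add: power_divide s)
    show "integrable M (?Y i)" unfolding js by (auto intro!: V_integrable)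
  qed (use n b in auto)
  also have "(\<lambda>x. MAX i\<in>?I. ?Y i x) = grid_inc n T"
    unfolding grid_inc_def by (auto simp: fun_eq_iff intro!: arg_cong[where f = Max] image_cong)
  also have "ln (real (card ?I) * exp 1) / (1 / b) = b * (ln (real (2 * n)) + 1)"
    using n by (simp add: card_cartesian_product ln_mult mult_ac)
  finally show ?thesis .
qed

lemma pickands_increment_bound:
  assumes "pickands_condition R A \<alpha>" "A > 0"
  obtains \<delta> where "\<delta> > 0" "\<And>t. 0 < t \<Longrightarrow> t < \<delta> \<Longrightarrow> R 0 - R t \<le> 2 * A * t powr \<alpha>"
proof -
  have "\<forall>\<^sub>F t in at 0. norm (R 0 - R t - A * \<bar>t\<bar> powr \<alpha>) \<le> A * norm (\<bar>t\<bar> powr \<alpha>)"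
    using assms unfolding pickands_condition_def by (intro landau_o.smallD) auto
  then obtain \<delta> where d: "\<delta> > 0"
    "\<And>t. t \<noteq> 0 \<Longrightarrow> dist t 0 < \<delta> \<Longrightarrow> norm (R 0 - R t - A * \<bar>t\<bar> powr \<alpha>) \<le> A * norm (\<bar>t\<bar> powr \<alpha>)"
    unfolding eventually_at by auto
  have "R 0 - R t \<le> 2 * A * t powr \<alpha>" if "0 < t" "t < \<delta>" for t
    using d(2)[of t] that by (simp add: abs_le_iff)
  with d(1) show ?thesis by (rule that)
qed

text \<open>Telescopes over dyadic refinements of a grid of \<open>N\<close> steps. Halving the mesh
  multiplies the increment scale by \<open>q\<close> and adds only \<open>ln 2\<close> to the
  logarithmic factor, so the series converges. The parameter \<open>l\<close> stays free to be tuned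
  to \<open>T\<close>.\<close>

lemma neg_sup_chaining:
  assumes T: "T > 0" and N: "N > 0" and l: "l > 0" and C: "C > 0" and \<alpha>: "\<alpha> > 0"
    and inc: "\<And>t. 0 < t \<Longrightarrow> t \<le> T / real N \<Longrightarrow> R 0 - R t \<le> C * t powr \<alpha>"
  defines "q \<equiv> 2 powr (- \<alpha> / 2)"
  shows "integrable M (neg_sup T)"
    and "expectation (neg_sup T) \<le> (ln (real (Suc N)) + l\<^sup>2 * \<sigma>\<^sup>2 / 2) / l
      + sqrt C * (T / real N) powr (\<alpha> / 2) * (ln (real (2 * N)) + 1) * (1 / (1 - q)\<^sup>2)"
proof -
  define b where "b = sqrt C * (T / real N) powr (\<alpha> / 2)"
  define D where "D = ln (real (2 * N)) + 1"
  have b: "b > 0" using T N C by (simp add: b_def)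
  have D: "D \<ge> 1" using N by (simp add: D_def)
  have q: "0 < q" "q < 1" using \<alpha> powr_less_mono[of "- \<alpha> / 2" 0 2] by (simp_all add: q_def)
  have qk: "q ^ k = 2 powr (- (\<alpha> / 2 * real k))" for k
    unfolding q_def by (simp add: powr_powr flip: powr_realpow)
  have powr_square: "(y powr z)\<^sup>2 = y powr (2 * z)" for y z :: real
    by (simp add: power2_eq_square flip: powr_add)
  have incE: "expectation (grid_inc (N * 2 ^ k) T) \<le> b * D * (real (Suc k) * q ^ k)" for k
  proof -
    have "(b * q ^ k)\<^sup>2 = C * (T / real (N * 2 ^ k)) powr \<alpha>"
    proof -
      have "(T / real (N * 2 ^ k)) powr \<alpha> = (T / real N) powr \<alpha> * 2 powr (- (\<alpha> * real k))"
      proof -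
        have eq: "T / real (N * 2 ^ k) = (T / real N) * 2 powr (- real k)"
          by (simp add: powr_minus powr_realpow divide_inverse)
        show ?thesis
          unfolding eq by (subst powr_mult) (use T N in \<open>auto simp: powr_powr mult.commute\<close>)
      qed
      moreover have "(b * q ^ k)\<^sup>2 = C * ((T / real N) powr \<alpha> * 2 powr (- (\<alpha> * real k)))"
        using C unfolding b_def qk power_mult_distrib powr_square by (simp add: mult.assoc)
      ultimately show ?thesis by simp
    qed
    moreover have "R 0 - R (T / real (N * 2 ^ k)) \<le> C * (T / real (N * 2 ^ k)) powr \<alpha>"
    proof (rule inc)
      show "0 < T / real (N * 2 ^ k)" using T N by simp
      have "real N * 1 \<le> real (N * 2 ^ k)" by (simp add: mult_le_cancel_left1)
      then show "T / real (N * 2 ^ k) \<le> T / real N" using T N by (intro divide_left_mono) auto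
    qed
    ultimately have "expectation (grid_inc (N * 2 ^ k) T) \<le> (b * q ^ k) * (ln (real (2 * (N * 2 ^ k))) + 1)"
      using N b q by (intro expectation_grid_inc_le) auto
    also have "ln (real (2 * (N * 2 ^ k))) + 1 \<le> D * real (Suc k)"
    proof -
      have "ln (real (2 * (N * 2 ^ k))) = ln (real (2 * N)) + real k * ln 2"
        using N ln_mult[of "real (2 * N)" "2 ^ k"] by (simp add: ln_realpow mult.assoc)
      moreover have "real k * ln 2 \<le> real k * D" using D ln_2_less_1 by (intro mult_left_mono) auto
      ultimately show ?thesis by (simp add: D_def algebra_simps)
    qed
    finally show ?thesis using b q by (simp add: mult_ac mult_left_mono)
  qed
  have grid: "expectation (grid_sup (N * 2 ^ K) T) \<le> expectation (grid_sup N T) + (\<Sum>k<K. expectation (grid_inc (N * 2 ^ Suc k) T))" for K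
  proof (induction K)
    case (Suc K)
    have "expectation (grid_sup (N * 2 ^ Suc K) T) \<le> expectation (\<lambda>x. grid_sup (N * 2 ^ K) T x + grid_inc (N * 2 ^ Suc K) T x)"
      using N grid_sup_refine[of "N * 2 ^ K" T]
      by (intro integral_mono Bochner_Integration.integrable_add grid_sup_integrable grid_inc_integrable) (auto simp: mult_ac)
    also have "\<dots> = expectation (grid_sup (N * 2 ^ K) T) + expectation (grid_inc (N * 2 ^ Suc K) T)"
      using N by (intro Bochner_Integration.integral_add grid_sup_integrable grid_inc_integrable) auto
    finally show ?case using Suc by simp
  qed simp
  let ?B = "(ln (real (Suc N)) + l\<^sup>2 * \<sigma>\<^sup>2 / 2) / l + b * D * (1 / (1 - q)\<^sup>2)"
  have bound: "expectation (grid_sup (N * 2 ^ K) T) \<le> ?B" for K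
  proof -
    have "(\<Sum>k<K. expectation (grid_inc (N * 2 ^ Suc k) T)) \<le> (\<Sum>k<K. b * D * (real (Suc (Suc k)) * q ^ Suc k))"
      by (intro sum_mono incE)
    \<comment> \<open>The increments start at level 1; adding the nonnegative term of level 0 shifts
      the index to the summed form.\<close>
    also have "\<dots> \<le> (\<Sum>k<Suc K. b * D * (real (Suc k) * q ^ k))"
      unfolding sum.lessThan_Suc_shift using b D by simp
    also have "\<dots> = b * D * (\<Sum>k<Suc K. real (Suc k) * q ^ k)" by (rule sum_distrib_left[symmetric])
    also have "\<dots> \<le> b * D * (1 / (1 - q)\<^sup>2)"
      using b D by (intro mult_left_mono sum_Suc_power_le q) auto
    finally show ?thesis using grid[of K] expectation_grid_sup_le[OF l, of N T] by linarith
  qed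
  \<comment> \<open>Nested grids make the maxima increase, so monotone convergence yields
    integrability of the supremum together with the bound.\<close>
  have "incseq (\<lambda>K. expectation (grid_sup (N * 2 ^ K) T))"
    using incseq_grid_sup[of N T] by (intro incseq_SucI integral_mono grid_sup_integrable) (auto simp: incseq_Suc_iff)
  then obtain E where E: "(\<lambda>K. expectation (grid_sup (N * 2 ^ K) T)) \<longlonglongrightarrow> E"
    using incseq_convergent bound by blast
  have mono: "AE x in M. mono (\<lambda>K. grid_sup (N * 2 ^ K) T x)" using incseq_grid_sup by auto
  have lim: "AE x in M. (\<lambda>K. grid_sup (N * 2 ^ K) T x) \<longlonglongrightarrow> neg_sup T x"
    using grid_sup_tendsto_dyadic[OF _ T N] by auto
  show "integrable M (neg_sup T)"
    by (rule integrable_monotone_convergence[OF grid_sup_integrable mono lim E]) simp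
  have "expectation (neg_sup T) = E"
    by (rule integral_monotone_convergence[OF grid_sup_integrable mono lim E]) simp
  also have "E \<le> ?B" using E bound by (intro LIMSEQ_le_const2) auto
  finally show "expectation (neg_sup T) \<le> (ln (real (Suc N)) + l\<^sup>2 * \<sigma>\<^sup>2 / 2) / l
      + sqrt C * (T / real N) powr (\<alpha> / 2) * (ln (real (2 * N)) + 1) * (1 / (1 - q)\<^sup>2)"
    by (simp add: b_def D_def)
qed

lemma expectation_neg_sup_upper:
  assumes P: "pickands_condition R A \<alpha>" "A > 0" and \<alpha>: "\<alpha> > 0" and \<epsilon>: "\<epsilon> > 0"
  shows "\<forall>\<^sub>F T in at_top. integrable M (neg_sup T) \<and> expectation (neg_sup T) \<le> sqrt 2 * \<sigma> * sqrt (ln T) + \<epsilon>"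
proof -
  obtain \<delta> where \<delta>: "\<delta> > 0" "\<And>t. 0 < t \<Longrightarrow> t < \<delta> \<Longrightarrow> R 0 - R t \<le> 2 * A * t powr \<alpha>"
    using pickands_increment_bound[OF P] by blast
  define S where "S = 1 / (1 - 2 powr (- \<alpha> / 2))\<^sup>2"
  have S: "S \<ge> 0" by (simp add: S_def)
  define c1 c2 where "c1 = \<sigma> / sqrt 2" and "c2 = sqrt (2 * A) * S"
  have "\<forall>\<^sub>F L in at_top. exp (- sqrt L) < \<delta>" using \<delta>(1) by real_asymp
  then have e1: "\<forall>\<^sub>F T in at_top. exp (- sqrt (sqrt (ln T))) < \<delta>"
    using sqrt_ln_at_top by (rule eventually_compose_filterlim)
  have "((\<lambda>L. c1 * ((sqrt L + ln 3) / L) + c2 * (exp (- (\<alpha> / 2) * sqrt L) * (L\<^sup>2 + sqrt L + ln 4 + 1))) \<longlongrightarrow> c1 * 0 + c2 * 0) at_top"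
    by (intro tendsto_intros; use \<alpha> in real_asymp)
  then have "\<forall>\<^sub>F L in at_top. c1 * ((sqrt L + ln 3) / L) + c2 * (exp (- (\<alpha> / 2) * sqrt L) * (L\<^sup>2 + sqrt L + ln 4 + 1)) < \<epsilon>"
    using \<epsilon> by (intro order_tendstoD(2)) auto
  then have e2: "\<forall>\<^sub>F T in at_top. c1 * ((sqrt (sqrt (ln T)) + ln 3) / sqrt (ln T))
      + c2 * (exp (- (\<alpha> / 2) * sqrt (sqrt (ln T))) * ((sqrt (ln T))\<^sup>2 + sqrt (sqrt (ln T)) + ln 4 + 1)) < \<epsilon>"
    using sqrt_ln_at_top by (rule eventually_compose_filterlim)
  show ?thesis
    using e1 e2 eventually_gt_at_top[of 1]
  proof eventually_elim
    case (elim T)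
    define L where "L = sqrt (ln T)"
    note elim = elim[folded L_def]
    have L: "L > 0" "L\<^sup>2 = ln T" using elim(3) by (simp_all add: L_def)
    \<comment> \<open>The mesh becomes about \<open>exp (- sqrt L)\<close>: fine enough that the
      chaining error beats the factor of order \<open>L\<^sup>2\<close>, yet the extra
      \<open>sqrt L\<close> in \<open>ln E\<close> vanishes after division by a multiple of
      \<open>L\<close>.\<close>
    define E where "E = T * exp (sqrt L)"
    define N where "N = nat \<lceil>E\<rceil>"
    have E1: "E \<ge> 1" using mult_mono[of 1 T 1 "exp (sqrt L)"] elim(3) L(1) by (simp add: E_def)
    have lnE: "ln E = L\<^sup>2 + sqrt L" using elim(3) by (simp add: E_def ln_mult L(2))
    have N: "E \<le> real N" "real N \<le> E + 1"
    proof -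
      have "real N = of_int \<lceil>E\<rceil>" using E1 by (simp add: N_def)
      then show "E \<le> real N" "real N \<le> E + 1" by linarith+
    qed
    have N0: "N > 0" using E1 N(1) by (cases N) auto
    have TN: "0 < T / real N" "T / real N \<le> exp (- sqrt L)"
    proof -
      show "0 < T / real N" using elim(3) N0 by simp
      have "T / real N \<le> T / E" using N E1 elim(3) by (intro divide_left_mono) auto
      also have "\<dots> = exp (- sqrt L)" using elim(3) by (simp add: E_def exp_minus inverse_eq_divide)
      finally show "T / real N \<le> exp (- sqrt L)" .
    qed
    have ln1: "ln (real (Suc N)) \<le> L\<^sup>2 + sqrt L + ln 3"
    proof -
      have "ln (real (Suc N)) \<le> ln (3 * E)" using N E1 by (subst ln_le_cancel_iff) auto
      then show ?thesis using E1 by (simp add: ln_mult lnE)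
    qed
    have ln2: "ln (real (2 * N)) \<le> L\<^sup>2 + sqrt L + ln 4"
    proof -
      have "ln (real (2 * N)) \<le> ln (4 * E)" using N E1 N0 by (subst ln_le_cancel_iff) auto
      then show ?thesis using E1 by (simp add: ln_mult lnE)
    qed
    have T0: "T > 0" using elim(3) by simp
    \<comment> \<open>This parameter minimises \<open>ln T / l + l * \<sigma>\<^sup>2 / 2\<close>,
      whose minimum is the desired level.\<close>
    have l: "sqrt 2 * L / \<sigma> > 0" using L sigma by simp
    have C: "2 * A > 0" using P by simp
    have inc: "R 0 - R t \<le> 2 * A * t powr \<alpha>" if "0 < t" "t \<le> T / real N" for t
      using that TN(2) elim(1) by (intro \<delta>(2)) auto
    note chain = neg_sup_chaining[OF T0 N0 l C \<alpha> inc, folded S_def]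
    have "(ln (real (Suc N)) + (sqrt 2 * L / \<sigma>)\<^sup>2 * \<sigma>\<^sup>2 / 2) / (sqrt 2 * L / \<sigma>) \<le>
        ((L\<^sup>2 + sqrt L + ln 3) + L\<^sup>2) / (sqrt 2 * L / \<sigma>)"
      using ln1 l sigma by (intro divide_right_mono) (auto simp: power_divide power_mult_distrib)
    also have "\<dots> = (\<sigma> / sqrt 2) * ((2 * L\<^sup>2 + (sqrt L + ln 3)) / L)" using L sigma by simp
    also have "(2 * L\<^sup>2 + (sqrt L + ln 3)) / L = 2 * L + (sqrt L + ln 3) / L"
      using L(1) by (simp add: add_divide_distrib power2_eq_square)
    also have "(\<sigma> / sqrt 2) * (2 * L + (sqrt L + ln 3) / L) = sqrt 2 * \<sigma> * L + c1 * ((sqrt L + ln 3) / L)"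
    proof -
      have "(\<sigma> / sqrt 2) * (2 * L) = sqrt 2 * \<sigma> * L" by (simp add: field_simps)
      then show ?thesis by (simp only: distrib_left c1_def)
    qed
    finally have 1: "(ln (real (Suc N)) + (sqrt 2 * L / \<sigma>)\<^sup>2 * \<sigma>\<^sup>2 / 2) / (sqrt 2 * L / \<sigma>) \<le> sqrt 2 * \<sigma> * L + c1 * ((sqrt L + ln 3) / L)" .
    have "(T / real N) powr (\<alpha> / 2) \<le> exp (- sqrt L) powr (\<alpha> / 2)"
      using TN \<alpha> by (intro powr_mono2) auto
    also have "\<dots> = exp (- (\<alpha> / 2) * sqrt L)" by (simp add: powr_def)
    finally have pw: "(T / real N) powr (\<alpha> / 2) \<le> exp (- (\<alpha> / 2) * sqrt L)" .
    have le: "(T / real N) powr (\<alpha> / 2) * (ln (real (2 * N)) + 1) \<le> exp (- (\<alpha> / 2) * sqrt L) * (L\<^sup>2 + sqrt L + ln 4 + 1)"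
      using pw ln2 N0 by (intro mult_mono) auto
    have 2: "sqrt (2 * A) * (T / real N) powr (\<alpha> / 2) * (ln (real (2 * N)) + 1) * S
        \<le> c2 * (exp (- (\<alpha> / 2) * sqrt L) * (L\<^sup>2 + sqrt L + ln 4 + 1))"
    proof -
      have "c2 \<ge> 0" using C S by (simp add: c2_def)
      from mult_left_mono[OF le this] show ?thesis by (simp only: c2_def mult_ac)
    qed
    show ?case
      using chain 1 2 elim(2) unfolding L_def by linarith
  qed
qed

section \<open>The two asymptotic equivalences\<close>

lemma exp_neg_sup_integrable: "T \<ge> 0 \<Longrightarrow> integrable M (\<lambda>x. exp (c - sqrt 2 * neg_sup T x))"
proof (rule Bochner_Integration.integrable_bound[where f = "\<lambda>x. exp c * exp (sqrt 2 * V 0 x)"])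
  show "integrable M (\<lambda>x. exp c * exp (sqrt 2 * V 0 x))" by (intro integrable_mult_right V_exp)
  assume "T \<ge> 0"
  show "AE x in M. norm (exp (c - sqrt 2 * neg_sup T x)) \<le> norm (exp c * exp (sqrt 2 * V 0 x))"
  proof (rule AE_I2)
    fix x assume "x \<in> space M"
    then have "- V 0 x \<le> neg_sup T x" using \<open>T \<ge> 0\<close> by (intro neg_sup_upper) auto
    then have "sqrt 2 * - V 0 x \<le> sqrt 2 * neg_sup T x" by (intro mult_left_mono) auto
    then show "norm (exp (c - sqrt 2 * neg_sup T x)) \<le> norm (exp c * exp (sqrt 2 * V 0 x))"
      by (simp add: norm_mult flip: exp_add)
  qed
qed auto

theorem G_inf_asymptotics:
  assumes P: "pickands_condition R A \<alpha>" "A > 0" "\<alpha> > 0" and berman: "berman_condition R"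
  shows "G_inf M V \<sim>[at_top] (\<lambda>T. exp (- 2 * \<sigma> * sqrt (ln T) - \<sigma>\<^sup>2))"
    and "(\<lambda>T. exp (expectation (\<lambda>x. INF t\<in>{0..T}. sqrt 2 * V t x - \<sigma>\<^sup>2))) \<sim>[at_top]
      (\<lambda>T. exp (- 2 * \<sigma> * sqrt (ln T) - \<sigma>\<^sup>2))"
proof -
  define F where "F = (\<lambda>T. exp (- 2 * \<sigma> * sqrt (ln T) - \<sigma>\<^sup>2))"
  \<comment> \<open>For nonnegative \<open>T\<close>, \<open>H\<close> is the quotient of G by
    \<open>F\<close>; \<open>J\<close> is eventually that of the exponentiated mean infimum. Both
    are squeezed together, since chaining bounds the smaller and the lower tail bounds the
    larger.\<close>
  define H where "H = (\<lambda>T. expectation (\<lambda>x. exp (2 * \<sigma> * sqrt (ln T) - sqrt 2 * neg_sup T x)))"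
  define J where "J = (\<lambda>T. exp (2 * \<sigma> * sqrt (ln T) - sqrt 2 * expectation (neg_sup T)))"
  have bounds: "\<forall>\<^sub>F T in at_top. exp (- sqrt 2 * \<epsilon>) \<le> J T \<and> J T \<le> H T \<and> H T \<le> exp (sqrt 2 * \<epsilon>) + \<epsilon>" if "\<epsilon> > 0" for \<epsilon>
    using expectation_neg_sup_upper[OF P that] expectation_exp_upper[OF berman that] eventually_ge_at_top[of 0]
  proof eventually_elim
    case (elim T)
    have "J T \<le> H T"
      using exp_expectation_le[of "\<lambda>x. 2 * \<sigma> * sqrt (ln T) - sqrt 2 * neg_sup T x"] elim exp_neg_sup_integrable[of T]
      unfolding J_def H_def by (simp add: prob_space)
    moreover have "exp (- sqrt 2 * \<epsilon>) \<le> J T"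
    proof -
      have "sqrt 2 * expectation (neg_sup T) \<le> sqrt 2 * (sqrt 2 * \<sigma> * sqrt (ln T) + \<epsilon>)"
        using elim by (intro mult_left_mono) auto
      then show ?thesis by (simp add: J_def algebra_simps)
    qed
    ultimately show ?case using elim unfolding H_def by simp
  qed
  have lim: "(X \<longlongrightarrow> 1) at_top"
    if X: "\<And>\<epsilon>. \<epsilon> > 0 \<Longrightarrow> \<forall>\<^sub>F T in at_top. exp (- sqrt 2 * \<epsilon>) \<le> X T \<and> X T \<le> exp (sqrt 2 * \<epsilon>) + \<epsilon>" for X :: "real \<Rightarrow> real"
  proof (rule order_tendstoI)
    fix a :: real assume "a < 1"
    have "((\<lambda>\<epsilon>. exp (- sqrt 2 * \<epsilon>)) \<longlongrightarrow> exp (- sqrt 2 * 0)) (at_right 0)" by (intro tendsto_intros)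
    then have "\<forall>\<^sub>F \<epsilon> in at_right 0. a < exp (- sqrt 2 * \<epsilon>)" using \<open>a < 1\<close> by (intro order_tendstoD(1)) auto
    then have "\<forall>\<^sub>F \<epsilon> in at_right 0. a < exp (- sqrt 2 * \<epsilon>) \<and> \<epsilon> > 0"
      using eventually_at_right_less[of "0::real"] by eventually_elim auto
    then obtain \<epsilon> where "a < exp (- sqrt 2 * \<epsilon>)" "\<epsilon> > 0"
      using eventually_happens'[OF trivial_limit_at_right_real] by blast
    then show "\<forall>\<^sub>F T in at_top. a < X T" using X[of \<epsilon>] by (auto elim!: eventually_mono)
  next
    fix a :: real assume "1 < a"
    have "((\<lambda>\<epsilon>. exp (sqrt 2 * \<epsilon>) + \<epsilon>) \<longlongrightarrow> exp (sqrt 2 * 0) + 0) (at_right 0)" by (intro tendsto_intros)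
    then have "\<forall>\<^sub>F \<epsilon> in at_right 0. exp (sqrt 2 * \<epsilon>) + \<epsilon> < a" using \<open>1 < a\<close> by (intro order_tendstoD(2)) auto
    then have "\<forall>\<^sub>F \<epsilon> in at_right 0. exp (sqrt 2 * \<epsilon>) + \<epsilon> < a \<and> \<epsilon> > 0"
      using eventually_at_right_less[of "0::real"] by eventually_elim auto
    then obtain \<epsilon> where "exp (sqrt 2 * \<epsilon>) + \<epsilon> < a" "\<epsilon> > 0"
      using eventually_happens'[OF trivial_limit_at_right_real] by blast
    then show "\<forall>\<^sub>F T in at_top. X T < a" using X[of \<epsilon>] by (auto elim!: eventually_mono)
  qed
  have "(H \<longlongrightarrow> 1) at_top" by (rule lim, rule eventually_mono[OF bounds]) auto
  moreover have "\<forall>\<^sub>F T in at_top. H T = G_inf M V T / F T"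
    using eventually_ge_at_top[of 0]
  proof eventually_elim
    case (elim T)
    have "F T * exp (2 * \<sigma> * sqrt (ln T) - sqrt 2 * neg_sup T x) = exp (- sqrt 2 * neg_sup T x - \<sigma>\<^sup>2)" for x
      unfolding F_def exp_add[symmetric] by (rule arg_cong[of _ _ exp]) simp
    then have "G_inf M V T = F T * H T"
      unfolding G_inf_eq[OF elim] H_def by (simp only: integral_mult_right_zero[symmetric])
    then show ?case by (simp add: F_def)
  qed
  ultimately have "((\<lambda>T. G_inf M V T / F T) \<longlongrightarrow> 1) at_top" by (rule Lim_transform_eventually)
  then show "G_inf M V \<sim>[at_top] (\<lambda>T. exp (- 2 * \<sigma> * sqrt (ln T) - \<sigma>\<^sup>2))"
    by (fold F_def) (rule asymp_equivI')
  have "(J \<longlongrightarrow> 1) at_top" by (rule lim, rule eventually_mono[OF bounds]) auto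
  moreover have "\<forall>\<^sub>F T in at_top. J T = exp (expectation (\<lambda>x. INF t\<in>{0..T}. sqrt 2 * V t x - \<sigma>\<^sup>2)) / F T"
    using eventually_ge_at_top[of 0] expectation_neg_sup_upper[OF P zero_less_one]
  proof eventually_elim
    case (elim T)
    \<comment> \<open>Integrability from the chaining bound is essential for splitting the
      expectation: the integral of a non-integrable function is 0 by convention.\<close>
    then have "expectation (\<lambda>x. INF t\<in>{0..T}. sqrt 2 * V t x - \<sigma>\<^sup>2) = - sqrt 2 * expectation (neg_sup T) - \<sigma>\<^sup>2"
      by (simp add: expectation_INF_eq prob_space)
    moreover have "J T * F T = exp (- sqrt 2 * expectation (neg_sup T) - \<sigma>\<^sup>2)"
      unfolding F_def J_def exp_add[symmetric] by (rule arg_cong[of _ _ exp]) simp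
    ultimately show ?case by (simp add: F_def field_simps)
  qed
  ultimately have "((\<lambda>T. exp (expectation (\<lambda>x. INF t\<in>{0..T}. sqrt 2 * V t x - \<sigma>\<^sup>2)) / F T) \<longlongrightarrow> 1) at_top"
    by (rule Lim_transform_eventually)
  then show "(\<lambda>T. exp (expectation (\<lambda>x. INF t\<in>{0..T}. sqrt 2 * V t x - \<sigma>\<^sup>2))) \<sim>[at_top]
      (\<lambda>T. exp (- 2 * \<sigma> * sqrt (ln T) - \<sigma>\<^sup>2))"
    by (fold F_def) (rule asymp_equivI')
qed

end

theorem theorem2p4:
  fixes M :: "'a measure" and V :: "real \<Rightarrow> 'a \<Rightarrow> real" and \<sigma> :: real
  assumes "prob_space M"
    and "gaussian_process M V"
    and "centered_process M V"
    and "stationary_process M V"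
    and "ergodic_process M V"
    and "continuous_sample_paths M V"
    and "\<sigma> > 0"
    and "\<And>t. prob_space.variance M (V t) = \<sigma>\<^sup>2"
  shows "(G_inf M V \<longlongrightarrow> 0) at_top
    \<and> (\<forall>A \<alpha>. 0 < \<alpha> \<and> \<alpha> \<le> 2 \<and> A > 0 \<and> pickands_condition (R_cov M V) A \<alpha> \<and> berman_condition (R_cov M V) \<longrightarrow>
          G_inf M V \<sim>[at_top]
            (\<lambda>T. exp (prob_space.expectation M (\<lambda>\<omega>. INF t\<in>{0..T}. sqrt 2 * V t \<omega> - \<sigma>\<^sup>2)))
        \<and> (\<lambda>T. exp (prob_space.expectation M (\<lambda>\<omega>. INF t\<in>{0..T}. sqrt 2 * V t \<omega> - \<sigma>\<^sup>2)))
            \<sim>[at_top] (\<lambda>T. exp (- 2 * \<sigma> * sqrt (ln T) - \<sigma>\<^sup>2)))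
    \<and> (berman_condition (R_cov M V) \<longrightarrow>
        (\<forall>C m. m > 0 \<longrightarrow> (\<lambda>T. p_inf M V T C) \<in> o[at_top](\<lambda>T. T powr (- m))))"
proof -
  interpret stationary_gaussian M V \<sigma>
    using assms by (intro stationary_gaussian.intro stationary_gaussian_axioms.intro)
  show ?thesis
  proof (intro conjI allI impI)
    show "(G_inf M V \<longlongrightarrow> 0) at_top" by (rule G_inf_tendsto_0) fact
  next
    fix A \<alpha> assume "0 < \<alpha> \<and> \<alpha> \<le> 2 \<and> A > 0 \<and> pickands_condition R A \<alpha> \<and> berman_condition R"
    then have P: "pickands_condition R A \<alpha>" "A > 0" "\<alpha> > 0" "berman_condition R" by auto
    show 1: "(\<lambda>T. exp (expectation (\<lambda>\<omega>. INF t\<in>{0..T}. sqrt 2 * V t \<omega> - \<sigma>\<^sup>2)))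
        \<sim>[at_top] (\<lambda>T. exp (- 2 * \<sigma> * sqrt (ln T) - \<sigma>\<^sup>2))"
      by (rule G_inf_asymptotics(2)[OF P])
    show "G_inf M V \<sim>[at_top] (\<lambda>T. exp (expectation (\<lambda>\<omega>. INF t\<in>{0..T}. sqrt 2 * V t \<omega> - \<sigma>\<^sup>2)))"
      by (rule asymp_equiv_trans[OF G_inf_asymptotics(1)[OF P] asymp_equiv_symI[OF 1]])
  next
    fix C m :: real assume "berman_condition R" "m > 0"
    then show "(\<lambda>T. p_inf M V T C) \<in> o[at_top](\<lambda>T. T powr (- m))" by (rule p_inf_smallo)
  qed
qed

end
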